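(* Let $f$ be a regular function on a symmetric slice domain $\Omega\subseteq\mathbb{H}$, let $x_0+y_0\mathbb{S}\subset\Omega$ (with $x_0,y_0\in\mathbb{R}$) and let $q_0\in x_0+y_0\mathbb{S}$. For $n\in\mathbb{N}$ set $A_{2n}=(R_{\bar q_0}R_{q_0})^nf(q_0)$ and $A_{2n+1}=R_{q_0}(R_{\bar q_0}R_{q_0})^nf(\bar q_0)$. For every $U=U(x_0+y_0\mathbb{S},R)$ (with $R>0$) such that $\overline{U}\subset\Omega$, there exists a constant $C>0$ such that $$|A_n|\leq C\cdot\frac{\max_{\partial U}|f|}{R^n}$$ for all $n\in\mathbb{N}$.
   Context: $\mathbb{H}$ is the real algebra of quaternions with conjugation $q\mapsto\bar q$ and modulus $|\cdot|$; $\mathbb{N}=\{0,1,2,\dots\}$; $\mathbb{S}=\{q\in\mathbb{H}:q^2=-1\}$; for $I\in\mathbb{S}$, $L_I=\mathbb{R}+I\mathbb{R}\simeq\mathbb{C}$; $x_0+y_0\mathbb{S}=\{x_0+y_0J:J\in\mathbb{S}\}$; and $U(x_0+y_0\mathbb{S},R)=\{q\in\mathbb{H}:|(q-x_0)^2+y_0^2|<R^2\}$. For a domain (connected open set) $\Omega\subseteq\mathbb{H}$ and $f:\Omega\to\mathbb{H}$, put $\Omega_I=\Omega\cap L_I$, $f_I=f|_{\Omega_I}$. The function $f$ is (slice) regular if for every $I\in\mathbb{S}$ the restriction $f_I$ is holomorphic, i.e. $\frac12\left(\frac{\partial}{\partial x}+I\frac{\partial}{\partial y}\right)f_I(x+Iy)=0$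 identically on $\Omega_I$. A domain $\Omega$ is a slice domain if it intersects the real axis and $\Omega_I$ is a domain in $L_I$ for all $I\in\mathbb{S}$; it is symmetric if $x+Iy\in\Omega$ (with $x,y\in\mathbb{R}$, $I\in\mathbb{S}$) implies $x+y\mathbb{S}\subseteq\Omega$. Regular product: if $f,g$ are regular on a symmetric slice domain $\Omega$, choose $I,J\in\mathbb{S}$ with $I\perp J$ and write $f_I=F+GJ$, $g_I=H+KJ$ with $F,G,H,K:\Omega_I\to L_I$ holomorphic; $f*g$ is the unique regular function on $\Omega$ whose restriction to $\Omega_I$ is $[F(z)H(z)-G(z)\overline{K(\bar z)}]+[F(z)K(z)+G(z)\overline{H(\bar z)}]J$ (independent of the choice of $I,J$). It extends the product $\left(\sum q^na_n\right)*\left(\sum q^nb_n\right)=\sum q^n\sum_{k=0}^na_kb_{n-k}$ of power series. Operator $R_{q_0}$: for $f$ regular on a symmetric slice domain $\Omega$ and $q_0\in\Omega$, $R_{q_0}f:\Omega\to\mathbb{H}$ denotes the (unique, known to exist) regular function such that $f(q)=f(q_0)+(q-q_0)*R_{q_0}f(q)$ on $\Omega$. (If $q_0\in L_I$, then $f(z)=f(q_0)+(z-q_0)R_{q_0}f(z)$ for $z\in\Omega_I$.) $(R_{\bar q_0}R_{q_0})^n$ denotes the $n$-th iterate of $f\mapsto R_{\bar q_0}(R_{q_0}f)$. *)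

theory Defs
  imports "HOL-Analysis.Analysis"
begin

section \<open>The real algebra of quaternions\<close>

datatype quat = Quat (qre: real) (qi: real) (qj: real) (qk: real)

lemma quat_eq_iff: "p = q \<longleftrightarrow> qre p = qre q \<and> qi p = qi q \<and> qj p = qj q \<and> qk p = qk q"
  by (cases p; cases q) auto

instantiation quat :: ab_group_add
begin

definition zero_quat :: quat where "0 = Quat 0 0 0 0"

definition plus_quat :: "quat \<Rightarrow> quat \<Rightarrow> quat" where
  "p + q = Quat (qre p + qre q) (qi p + qi q) (qj p + qj q) (qk p + qk q)"

definition uminus_quat :: "quat \<Rightarrow> quat" where
  "- q = Quat (- qre q) (- qi q) (- qj q) (- qk q)"

definition minus_quat :: "quat \<Rightarrow> quat \<Rightarrow> quat" where
  "p - q = Quat (qre p - qre q) (qi p - qi q) (qj p - qj q) (qk p - qk q)"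

instance
  by standard (simp_all add: quat_eq_iff zero_quat_def plus_quat_def uminus_quat_def minus_quat_def)

end

lemma quat_zero_sel [simp]: "qre 0 = 0" "qi 0 = 0" "qj 0 = 0" "qk 0 = 0"
  by (simp_all add: zero_quat_def)

lemma quat_plus_sel [simp]:
  "qre (p + q) = qre p + qre q" "qi (p + q) = qi p + qi q"
  "qj (p + q) = qj p + qj q" "qk (p + q) = qk p + qk q"
  by (simp_all add: plus_quat_def)

lemma quat_uminus_sel [simp]:
  "qre (- q) = - qre q" "qi (- q) = - qi q" "qj (- q) = - qj q" "qk (- q) = - qk q"
  by (simp_all add: uminus_quat_def)

lemma quat_minus_sel [simp]:
  "qre (p - q) = qre p - qre q" "qi (p - q) = qi p - qi q"
  "qj (p - q) = qj p - qj q" "qk (p - q) = qk p - qk q"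
  by (simp_all add: minus_quat_def)

instantiation quat :: ring_1
begin

definition one_quat :: quat where "1 = Quat 1 0 0 0"

definition times_quat :: "quat \<Rightarrow> quat \<Rightarrow> quat" where
  "p * q = Quat
     (qre p * qre q - qi p * qi q - qj p * qj q - qk p * qk q)
     (qre p * qi q + qi p * qre q + qj p * qk q - qk p * qj q)
     (qre p * qj q - qi p * qk q + qj p * qre q + qk p * qi q)
     (qre p * qk q + qi p * qj q - qj p * qi q + qk p * qre q)"

instance
  by standard (simp_all add: quat_eq_iff one_quat_def times_quat_def algebra_simps)

end

lemma quat_one_sel [simp]: "qre 1 = 1" "qi 1 = 0" "qj 1 = 0" "qk 1 = 0"
  by (simp_all add: one_quat_def)

lemma quat_times_sel [simp]:
  "qre (p * q) = qre p * qre q - qi p * qi q - qj p * qj q - qk p * qk q"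
  "qi (p * q) = qre p * qi q + qi p * qre q + qj p * qk q - qk p * qj q"
  "qj (p * q) = qre p * qj q - qi p * qk q + qj p * qre q + qk p * qi q"
  "qk (p * q) = qre p * qk q + qi p * qj q - qj p * qi q + qk p * qre q"
  by (simp_all add: times_quat_def)

instantiation quat :: real_algebra_1
begin

definition scaleR_quat :: "real \<Rightarrow> quat \<Rightarrow> quat" where
  "r *\<^sub>R q = Quat (r * qre q) (r * qi q) (r * qj q) (r * qk q)"

instance
  by standard (simp_all add: quat_eq_iff scaleR_quat_def algebra_simps)

end

lemma quat_scaleR_sel [simp]:
  "qre (r *\<^sub>R q) = r * qre q" "qi (r *\<^sub>R q) = r * qi q"
  "qj (r *\<^sub>R q) = r * qj q" "qk (r *\<^sub>R q) = r * qk q"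
  by (simp_all add: scaleR_quat_def)

lemma quat_of_real_sel [simp]:
  "qre (of_real r) = r" "qi (of_real r) = 0" "qj (of_real r) = 0" "qk (of_real r) = 0"
  by (simp_all add: of_real_def)

definition qcnj :: "quat \<Rightarrow> quat" where
  "qcnj q = Quat (qre q) (- qi q) (- qj q) (- qk q)"

lemma quat_qcnj_sel [simp]:
  "qre (qcnj q) = qre q" "qi (qcnj q) = - qi q" "qj (qcnj q) = - qj q" "qk (qcnj q) = - qk q"
  by (simp_all add: qcnj_def)

instantiation quat :: real_inner
begin

definition inner_quat_def:
  "(p::quat) \<bullet> q = qre p * qre q + qi p * qi q + qj p * qj q + qk p * qk q"

definition norm_quat_def:
  "norm (q::quat) = sqrt ((qre q)\<^sup>2 + (qi q)\<^sup>2 + (qj q)\<^sup>2 + (qk q)\<^sup>2)"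

definition dist_quat_def:
  "dist (p::quat) q = norm (p - q)"

definition sgn_quat_def:
  "sgn (q::quat) = q /\<^sub>R norm q"

definition uniformity_quat_def:
  "(uniformity :: (quat \<times> quat) filter) = (INF e\<in>{0<..}. principal {(p, q). dist p q < e})"

definition open_quat_def:
  "open (U :: quat set) \<longleftrightarrow> (\<forall>p\<in>U. eventually (\<lambda>(p', q). p' = p \<longrightarrow> q \<in> U) uniformity)"

instance
proof
  fix p q r :: quat and a :: real and U :: "quat set"
  show "dist p q = norm (p - q)" by (rule dist_quat_def)
  show "sgn q = q /\<^sub>R norm q" by (rule sgn_quat_def)
  show "(uniformity :: (quat \<times> quat) filter) = (INF e\<in>{0<..}. principal {(p, q). dist p q < e})"
    by (rule uniformity_quat_def)
  show "open U \<longleftrightarrow> (\<forall>p\<in>U. eventually (\<lambda>(p', q). p' = p \<longrightarrow> q \<in> U) uniformity)"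
    by (rule open_quat_def)
  show "p \<bullet> q = q \<bullet> p" by (simp add: inner_quat_def algebra_simps)
  show "(p + q) \<bullet> r = p \<bullet> r + q \<bullet> r" by (simp add: inner_quat_def algebra_simps)
  show "(a *\<^sub>R p) \<bullet> q = a * (p \<bullet> q)" by (simp add: inner_quat_def algebra_simps)
  show "0 \<le> q \<bullet> q" by (simp add: inner_quat_def)
  have nn: "x * x + y * y + z * z + w * w = 0 \<longleftrightarrow> x = 0 \<and> y = 0 \<and> z = 0 \<and> w = 0"
    for x y z w :: real
  proof -
    have "0 \<le> x * x" "0 \<le> y * y" "0 \<le> z * z" "0 \<le> w * w" by simp_all
    then have "x * x + y * y + z * z + w * w = 0 \<longleftrightarrow> x * x = 0 \<and> y * y = 0 \<and> z * z = 0 \<and> w * w = 0"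
      by linarith
    then show ?thesis by simp
  qed
  show "q \<bullet> q = 0 \<longleftrightarrow> q = 0" by (simp add: inner_quat_def quat_eq_iff nn)
  show "norm q = sqrt (q \<bullet> q)" by (simp add: norm_quat_def inner_quat_def power2_eq_square)
qed

end

instantiation quat :: inverse
begin

definition inverse_quat_def:
  "inverse (q::quat) = qcnj q /\<^sub>R (norm q)\<^sup>2"

definition divide_quat_def:
  "(p::quat) div q = p * inverse q"

instance ..

end

instance quat :: real_normed_div_algebra
proof
  fix p q :: quat
  have nsq: "(norm q)\<^sup>2 = (qre q)\<^sup>2 + (qi q)\<^sup>2 + (qj q)\<^sup>2 + (qk q)\<^sup>2" for q :: quat
    by (simp add: norm_quat_def)
  have "(norm (p * q))\<^sup>2 = (norm p * norm q)\<^sup>2"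
    unfolding power_mult_distrib nsq quat_times_sel by algebra
  then show "norm (p * q) = norm p * norm q"
    by simp
  have 1: "qcnj q * q = of_real ((norm q)\<^sup>2)" and 2: "q * qcnj q = of_real ((norm q)\<^sup>2)"
    unfolding nsq quat_eq_iff quat_times_sel quat_of_real_sel quat_qcnj_sel
    by (intro conjI; algebra)+
  have 3: "of_real ((norm q)\<^sup>2) /\<^sub>R (norm q)\<^sup>2 = (1::quat)" if "q \<noteq> 0"
    unfolding of_real_def using that by simp
  show "inverse q * q = 1" if "q \<noteq> 0"
    unfolding inverse_quat_def mult_scaleR_left 1 by (rule 3[OF that])
  show "q * inverse q = 1" if "q \<noteq> 0"
    unfolding inverse_quat_def mult_scaleR_right 2 by (rule 3[OF that])
  show "p / q = p * inverse q" by (rule divide_quat_def)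
  show "inverse (0::quat) = 0" unfolding inverse_quat_def by (simp add: quat_eq_iff)
qed

instantiation quat :: euclidean_space
begin

definition Basis_quat_def:
  "(Basis :: quat set) = {Quat 1 0 0 0, Quat 0 1 0 0, Quat 0 0 1 0, Quat 0 0 0 1}"

instance
proof
  show "(Basis :: quat set) \<noteq> {}" and "finite (Basis :: quat set)"
    by (simp_all add: Basis_quat_def)
  show "u \<bullet> v = (if u = v then 1 else 0)" if "u \<in> Basis" "v \<in> Basis" for u v :: quat
    using that unfolding Basis_quat_def inner_quat_def by (elim insertE emptyE) simp_all
  show "(\<forall>u\<in>Basis. x \<bullet> u = 0) \<longleftrightarrow> x = 0" for x :: quat
    unfolding Basis_quat_def inner_quat_def quat_eq_iff[of x 0] by simp
qed

end


section \<open>Slices\<close>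

definition imag_units :: "quat set" where
  "imag_units = {q. q\<^sup>2 = - 1}"

definition slice_plane :: "quat \<Rightarrow> quat set" where
  "slice_plane I = {of_real x + I * of_real y | x y. True}"

definition sphere_at :: "real \<Rightarrow> real \<Rightarrow> quat set" where
  "sphere_at x y = {of_real x + of_real y * J | J. J \<in> imag_units}"

definition U_nbhd :: "real \<Rightarrow> real \<Rightarrow> real \<Rightarrow> quat set" where
  "U_nbhd x0 y0 R = {q. norm ((q - of_real x0)\<^sup>2 + (of_real y0)\<^sup>2) < R\<^sup>2}"

definition slice_domain :: "quat set \<Rightarrow> bool" where
  "slice_domain \<Omega> \<longleftrightarrow>
     open \<Omega> \<and> connected \<Omega> \<and> \<Omega> \<inter> \<real> \<noteq> {} \<and>
     (\<forall>I\<in>imag_units. openin (top_of_set (slice_plane I)) (\<Omega> \<inter> slice_plane I) \<and>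
        connected (\<Omega> \<inter> slice_plane I))"

definition symmetric_set :: "quat set \<Rightarrow> bool" where
  "symmetric_set \<Omega> \<longleftrightarrow>
     (\<forall>x y. \<forall>I\<in>imag_units. of_real x + I * of_real y \<in> \<Omega> \<longrightarrow> sphere_at x y \<subseteq> \<Omega>)"


section \<open>Slice regular functions\<close>

text \<open>
  Functions on a domain are represented by total functions on \<^typ>\<open>quat\<close>; only their values on
  the domain matter, since all domains and their slices are open (in the slice plane).
\<close>

definition slice_dbar :: "quat \<Rightarrow> (quat \<Rightarrow> quat) \<Rightarrow> real \<Rightarrow> real \<Rightarrow> quat" where
  "slice_dbar I f x y =
     (1/2) *\<^sub>R (vector_derivative (\<lambda>s. f (of_real s + I * of_real y)) (at x) +
               I * vector_derivative (\<lambda>t. f (of_real x + I * of_real t)) (at y))"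

text \<open>
  \<^term>\<open>W\<close> is meant to be a relatively open subset of \<^term>\<open>slice_plane I\<close>. As usual for
  holomorphy, real differentiability is required together with the Cauchy-Riemann equation
  (mere existence of the partial derivatives would not suffice).
\<close>

definition slice_holomorphic_on :: "quat \<Rightarrow> (quat \<Rightarrow> quat) \<Rightarrow> quat set \<Rightarrow> bool" where
  "slice_holomorphic_on I f W \<longleftrightarrow>
     (\<forall>x y. of_real x + I * of_real y \<in> W \<longrightarrow>
        (\<lambda>(s, t). f (of_real s + I * of_real t)) differentiable (at (x, y)) \<and>
        slice_dbar I f x y = 0)"

definition slice_regular_on :: "(quat \<Rightarrow> quat) \<Rightarrow> quat set \<Rightarrow> bool" where
  "slice_regular_on f \<Omega> \<longleftrightarrow>
     (\<forall>I\<in>imag_units. slice_holomorphic_on I f (\<Omega> \<inter> slice_plane I))"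

definition slice_splitting ::
    "quat set \<Rightarrow> quat \<Rightarrow> quat \<Rightarrow> (quat \<Rightarrow> quat) \<Rightarrow> (quat \<Rightarrow> quat) \<Rightarrow> (quat \<Rightarrow> quat) \<Rightarrow> bool" where
  "slice_splitting \<Omega> I J f F G \<longleftrightarrow>
     slice_holomorphic_on I F (\<Omega> \<inter> slice_plane I) \<and>
     slice_holomorphic_on I G (\<Omega> \<inter> slice_plane I) \<and>
     (\<forall>z\<in>\<Omega> \<inter> slice_plane I. F z \<in> slice_plane I \<and> G z \<in> slice_plane I \<and> f z = F z + G z * J)"

text \<open>
  In the next two definitions, uniqueness holds among functions on \<^term>\<open>\<Omega>\<close>; the value \<open>0\<close>
  is prescribed outside \<^term>\<open>\<Omega>\<close> so that the total function is unique as well.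
\<close>

definition regular_product ::
    "quat set \<Rightarrow> (quat \<Rightarrow> quat) \<Rightarrow> (quat \<Rightarrow> quat) \<Rightarrow> quat \<Rightarrow> quat" where
  "regular_product \<Omega> f g = (THE h.
     slice_regular_on h \<Omega> \<and> (\<forall>q. q \<notin> \<Omega> \<longrightarrow> h q = 0) \<and>
     (\<exists>I J F G H K. I \<in> imag_units \<and> J \<in> imag_units \<and> orthogonal I J \<and>
        slice_splitting \<Omega> I J f F G \<and> slice_splitting \<Omega> I J g H K \<and>
        (\<forall>z\<in>\<Omega> \<inter> slice_plane I.
           h z = (F z * H z - G z * qcnj (K (qcnj z))) +
                 (F z * K z + G z * qcnj (H (qcnj z))) * J)))"

definition R_op :: "quat set \<Rightarrow> quat \<Rightarrow> (quat \<Rightarrow> quat) \<Rightarrow> quat \<Rightarrow> quat" where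
  "R_op \<Omega> q0 f = (THE g.
     slice_regular_on g \<Omega> \<and> (\<forall>q. q \<notin> \<Omega> \<longrightarrow> g q = 0) \<and>
     (\<forall>q\<in>\<Omega>. f q = f q0 + regular_product \<Omega> (\<lambda>p. p - q0) g q))"

definition RR_iter :: "quat set \<Rightarrow> quat \<Rightarrow> nat \<Rightarrow> (quat \<Rightarrow> quat) \<Rightarrow> quat \<Rightarrow> quat" where
  "RR_iter \<Omega> q0 n = (\<lambda>h. R_op \<Omega> (qcnj q0) (R_op \<Omega> q0 h)) ^^ n"

definition A_coeff :: "quat set \<Rightarrow> (quat \<Rightarrow> quat) \<Rightarrow> quat \<Rightarrow> nat \<Rightarrow> quat" where
  "A_coeff \<Omega> f q0 m =
     (if even m then RR_iter \<Omega> q0 (m div 2) f q0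
      else R_op \<Omega> q0 (RR_iter \<Omega> q0 (m div 2) f) (qcnj q0))"

end

theory Submission
  imports Defs "HOL-Complex_Analysis.Complex_Analysis"
begin

text \<open>
  Let \<open>I\<close> be an imaginary unit with \<open>q0 = x0 + y0 I\<close> and write \<open>w0 = x0 + y0 \<i>\<close> for the complex
  number that corresponds to \<open>q0\<close> under \<open>L_I \<simeq> \<complex>\<close>.  On \<open>L_I\<close> the regular product with \<open>q - q0\<close> is
  pointwise left multiplication by \<open>z - w0\<close>, so there the operator \<open>R_op\<close> at \<open>q0\<close> is an ordinary divided
  difference.  Hence the \<open>A_n\<close> are the iterated divided differences of the restriction of \<open>f\<close> to the
  slice, at the nodes \<open>w0, cnj w0, w0, cnj w0, \<dots>\<close>.  Quaternionic values are split into two complex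
  coordinates that are linear for left multiplication by \<open>L_I\<close>, so it is enough to bound the iterated
  divided differences of a complex holomorphic function \<open>F\<close>.

  The product of the two linear factors is \<open>p z = (z - w0)(z - cnj w0) = (z - x0)\<^sup>2 + y0\<^sup>2\<close>, and \<open>U\<close>
  meets the slice in \<open>{z. |p z| < R\<^sup>2}\<close>.  This set is bounded by a Cassini oval, which may have two
  components or, for \<open>R = |y0|\<close>, be a lemniscate.  Rather than integrating along this curve, push \<open>F\<close>
  forward along \<open>p\<close>: symmetrising over the two preimages \<open>x0 \<plusminus> u\<close> of a point gives
  \<open>F = a \<circ> p + (z - x0) (b \<circ> p)\<close> with \<open>a\<close> and \<open>b\<close> holomorphic on a disc of radius greater than \<open>R\<^sup>2\<close>
  (\<open>quadratic_decomposition\<close>).  Forming both divided differences drops the constant Taylor coefficients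
  of \<open>a\<close> and \<open>b\<close> and shifts the others, so if \<open>a_k\<close> and \<open>b_k\<close> are these coefficients, then
  \<open>A_(2k) = a_k + (w0 - x0) b_k\<close> and \<open>A_(2k+1) = b_k\<close> for \<open>F\<close>.

  Let \<open>M\<close> be the supremum of \<open>|f|\<close> over the boundary of \<open>U\<close>.  On the circle \<open>|w| = R\<^sup>2\<close> one has \<open>|a| \<le> M\<close>,
  and Cauchy's inequality gives \<open>|a_k| \<le> M / R\<^sup>2\<^sup>k\<close>.  For \<open>b\<close> only \<open>|b w| |w - y0\<^sup>2|\<^sup>1\<^sup>/\<^sup>2 \<le> M\<close> is available,
  which does not bound \<open>b\<close> uniformly when the circle passes through or near the branch value \<open>y0\<^sup>2\<close>.
  But \<open>|w - y0\<^sup>2|\<^sup>-\<^sup>1\<^sup>/\<^sup>2\<close> is integrable along the circle, with a bound that does not depend on \<open>y0\<close>, and the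
  Cauchy integral for \<open>b_k\<close> yields \<open>|b_k| \<le> 3 M / R\<^sup>2\<^sup>k\<^sup>+\<^sup>1\<close> (\<open>taylor_coeff_bound_inverse_sqrt\<close>).
  The resulting constant \<open>C = 6 (1 + |y0| / R)\<close> does not depend on \<open>f\<close>.

  The regular product and \<open>R_op\<close> are defined by description, so their existence and uniqueness have to be
  established as well.  Both rest on the representation formula: a regular function on a symmetric slice
  domain is determined by its values on one slice, and every slice-holomorphic function on one slice
  extends (\<open>slice_extend_regular\<close>, \<open>representation_formula\<close>).
\<close>

section \<open>Slices as copies of the complex plane\<close>

definition slice_embed :: "quat \<Rightarrow> complex \<Rightarrow> quat" where
  "slice_embed I z = of_real (Re z) + I * of_real (Im z)"

text \<open>
  The left inverse of \<open>slice_embed I\<close> given by orthogonal projection to \<open>L_I\<close>.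
\<close>

definition slice_coord :: "quat \<Rightarrow> quat \<Rightarrow> complex" where
  "slice_coord I q = Complex (qre q) (q \<bullet> I)"

text \<open>
  The two complex coordinates of a quaternion: \<open>q = z1 + z2 J\<close> with \<open>z1, z2 \<in> L_I\<close>, where \<open>z1\<close> is the
  part of \<open>q\<close> that commutes with \<open>I\<close> and \<open>z2 J\<close> the part that anticommutes with \<open>I\<close>.
\<close>

definition slice_coord1 :: "quat \<Rightarrow> quat \<Rightarrow> complex" where
  "slice_coord1 I q = slice_coord I ((1/2) *\<^sub>R (q - I * q * I))"

definition slice_coord2 :: "quat \<Rightarrow> quat \<Rightarrow> quat \<Rightarrow> complex" where
  "slice_coord2 I J q = slice_coord I (- (1/2) *\<^sub>R (q + I * q * I) * J)"

lemma imag_unit_sq: "I \<in> imag_units \<Longrightarrow> I * I = - 1"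
  by (simp add: imag_units_def power2_eq_square)

lemma imag_unit_sq': "I \<in> imag_units \<Longrightarrow> I * (I * q) = - q"
  by (metis imag_unit_sq mult.assoc mult_minus1)

lemma imag_unit_norm: "I \<in> imag_units \<Longrightarrow> norm I = 1"
  using imag_unit_sq[of I] norm_mult[of I I]
  by (metis norm_minus_cancel norm_one norm_ge_zero abs_norm_cancel real_sqrt_abs2 real_sqrt_one)

lemma imag_units_iff: "I \<in> imag_units \<longleftrightarrow> qre I = 0 \<and> (qi I)\<^sup>2 + (qj I)\<^sup>2 + (qk I)\<^sup>2 = 1"
proof
  assume I: "I \<in> imag_units"
  have n: "(qre I)\<^sup>2 + (qi I)\<^sup>2 + (qj I)\<^sup>2 + (qk I)\<^sup>2 = 1"
    using imag_unit_norm[OF I] by (simp add: norm_quat_def)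
  have "qre (I * I) = - 1"
    using imag_unit_sq[OF I] by simp
  then have "(qre I)\<^sup>2 - (qi I)\<^sup>2 - (qj I)\<^sup>2 - (qk I)\<^sup>2 = - 1"
    by (simp add: power2_eq_square)
  with n have "(qre I)\<^sup>2 = 0" "(qi I)\<^sup>2 + (qj I)\<^sup>2 + (qk I)\<^sup>2 = 1"
    by linarith+
  then show "qre I = 0 \<and> (qi I)\<^sup>2 + (qj I)\<^sup>2 + (qk I)\<^sup>2 = 1"
    by simp
next
  assume "qre I = 0 \<and> (qi I)\<^sup>2 + (qj I)\<^sup>2 + (qk I)\<^sup>2 = 1"
  then show "I \<in> imag_units"
    by (simp add: imag_units_def quat_eq_iff power2_eq_square)
qed

lemma uminus_imag_unit: "I \<in> imag_units \<Longrightarrow> - I \<in> imag_units"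
  by (simp add: imag_units_iff)

lemma ex_imag_unit_form: "\<exists>J\<in>imag_units. \<exists>x y. q = of_real x + J * of_real y"
proof (cases "qi q = 0 \<and> qj q = 0 \<and> qk q = 0")
  case True
  have "Quat 0 1 0 0 \<in> imag_units" by (simp add: imag_units_iff)
  moreover have "q = of_real (qre q) + Quat 0 1 0 0 * of_real 0"
    using True by (simp add: quat_eq_iff)
  ultimately show ?thesis by blast
next
  case False
  define r where "r = sqrt ((qi q)\<^sup>2 + (qj q)\<^sup>2 + (qk q)\<^sup>2)"
  have "(qi q)\<^sup>2 + (qj q)\<^sup>2 + (qk q)\<^sup>2 \<noteq> 0"
    using False by (smt (verit) zero_le_power2 power2_eq_iff_nonneg zero_eq_power2)
  then have r: "r \<noteq> 0" "r\<^sup>2 = (qi q)\<^sup>2 + (qj q)\<^sup>2 + (qk q)\<^sup>2"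
    by (simp_all add: r_def)
  define J where "J = Quat 0 (qi q / r) (qj q / r) (qk q / r)"
  have "(qi q)\<^sup>2 / r\<^sup>2 + (qj q)\<^sup>2 / r\<^sup>2 + (qk q)\<^sup>2 / r\<^sup>2 = 1"
    using r(1) unfolding add_divide_distrib[symmetric] r(2)[symmetric] by simp
  then have "J \<in> imag_units"
    by (simp add: imag_units_iff J_def power_divide)
  moreover have "q = of_real (qre q) + J * of_real r"
    using r by (simp add: quat_eq_iff J_def)
  ultimately show ?thesis by blast
qed

lemma imag_units_anticommute:
  assumes "I \<in> imag_units" "J \<in> imag_units" "orthogonal I J"
  shows "J * I = - (I * J)"
  using assms
  by (simp add: imag_units_iff orthogonal_def inner_quat_def quat_eq_iff algebra_simps)

lemma ex_orthogonal_imag_unit: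
  assumes "I \<in> imag_units"
  shows "\<exists>J\<in>imag_units. orthogonal I J"
proof (cases "qi I = 0 \<and> qj I = 0")
  case True
  have "Quat 0 1 0 0 \<in> imag_units" by (simp add: imag_units_iff)
  moreover have "orthogonal I (Quat 0 1 0 0)"
    using True by (simp add: orthogonal_def inner_quat_def)
  ultimately show ?thesis by blast
next
  case False
  define r where "r = sqrt ((qi I)\<^sup>2 + (qj I)\<^sup>2)"
  have "(qi I)\<^sup>2 + (qj I)\<^sup>2 \<noteq> 0"
    using False by (smt (verit) zero_le_power2 zero_eq_power2)
  then have r: "r \<noteq> 0" "r\<^sup>2 = (qi I)\<^sup>2 + (qj I)\<^sup>2"
    by (simp_all add: r_def)
  define J where "J = Quat 0 (- qj I / r) (qi I / r) 0"
  have "(qi I)\<^sup>2 / r\<^sup>2 + (qj I)\<^sup>2 / r\<^sup>2 = 1"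
    using r(1) unfolding add_divide_distrib[symmetric] r(2)[symmetric] by simp
  then have "J \<in> imag_units"
    by (simp add: imag_units_iff J_def power_divide add.commute)
  moreover have "orthogonal I J"
    by (simp add: orthogonal_def inner_quat_def J_def)
  ultimately show ?thesis by blast
qed

lemma of_real_commute_quat: "(q::quat) * of_real r = of_real r * q"
  by (simp add: quat_eq_iff)

lemma slice_embed_add: "slice_embed I (z + w) = slice_embed I z + slice_embed I w"
  by (simp add: slice_embed_def algebra_simps)

lemma slice_embed_diff: "slice_embed I (z - w) = slice_embed I z - slice_embed I w"
  by (simp add: slice_embed_def algebra_simps)

lemma slice_embed_of_real: "slice_embed I (of_real x) = of_real x"
  by (simp add: slice_embed_def)

lemma slice_embed_mult:
  assumes "I \<in> imag_units"
  shows "slice_embed I (z * w) = slice_embed I z * slice_embed I w"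
proof -
  have "of_real a * I = I * of_real a" for a
    by (simp add: of_real_commute_quat)
  then show ?thesis
    using imag_unit_sq[OF assms]
    apply (simp add: slice_embed_def quat_eq_iff imag_units_iff algebra_simps)
    by algebra
qed

lemma slice_embed_i: "slice_embed I \<i> = I"
  by (simp add: slice_embed_def)

lemma slice_embed_cnj:
  "I \<in> imag_units \<Longrightarrow> slice_embed I (cnj z) = qcnj (slice_embed I z)"
  by (simp add: slice_embed_def quat_eq_iff imag_units_iff)

lemma norm_slice_embed:
  assumes "I \<in> imag_units"
  shows "norm (slice_embed I z) = norm z"
proof -
  have "(norm (slice_embed I z))\<^sup>2 = (norm z)\<^sup>2"
    using assms unfolding cmod_power2 norm_quat_def slice_embed_def imag_units_iff
    apply simp by algebra
  then show ?thesis by simp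
qed

lemma slice_embed_eq_iff:
  assumes "I \<in> imag_units"
  shows "slice_embed I z = slice_embed I w \<longleftrightarrow> z = w"
  using norm_slice_embed[OF assms, of "z - w"] by (auto simp: slice_embed_diff)

lemma slice_plane_eq_range: "slice_plane I = range (slice_embed I)"
proof -
  have "of_real x + I * of_real y = slice_embed I (Complex x y)" for x y
    by (simp add: slice_embed_def)
  then show ?thesis
    unfolding slice_plane_def by auto (metis complex.collapse)
qed

lemma bounded_linear_slice_embed: "bounded_linear (slice_embed I)"
  unfolding slice_embed_def
  by (intro bounded_linear_add bounded_linear_const_mult bounded_linear_compose[OF bounded_linear_of_real]
      bounded_linear_Re bounded_linear_Im)

lemma bounded_linear_slice_coord: "bounded_linear (slice_coord I)"
proof -
  have "slice_coord I q = of_real (q \<bullet> 1) + \<i> * of_real (q \<bullet> I)" for q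
    by (simp add: slice_coord_def complex_eq_iff inner_quat_def)
  then have "slice_coord I = (\<lambda>q. of_real (q \<bullet> 1) + \<i> * of_real (q \<bullet> I))"
    by blast
  then show ?thesis
    by (simp add: bounded_linear_add bounded_linear_const_mult
        bounded_linear_compose[OF bounded_linear_of_real] bounded_linear_inner_left)
qed

lemma slice_embed_coord:
  assumes I: "I \<in> imag_units" and "q * I = I * q"
  shows "slice_embed I (slice_coord I q) = q"
  using assms
  apply (simp add: imag_units_iff quat_eq_iff slice_embed_def slice_coord_def inner_quat_def)
  apply (intro conjI)
  by algebra+

lemma slice_coord_embed:
  assumes I: "I \<in> imag_units"
  shows "slice_coord I (slice_embed I z) = z"
  using assms
  apply (simp add: imag_units_iff complex_eq_iff slice_embed_def slice_coord_def inner_quat_def)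
  by algebra

lemma slice_embed_commute:
  assumes I: "I \<in> imag_units"
  shows "slice_embed I z * slice_embed I w = slice_embed I w * slice_embed I z"
  by (metis assms mult.commute slice_embed_mult)

lemma slice_embed_commute_I:
  assumes I: "I \<in> imag_units"
  shows "I * slice_embed I w = slice_embed I w * I"
  by (metis assms slice_embed_commute slice_embed_i)

lemma slice_embed_coord1:
  assumes I: "I \<in> imag_units"
  shows "slice_embed I (slice_coord1 I q) = (1/2) *\<^sub>R (q - I * q * I)"
  unfolding slice_coord1_def
  by (rule slice_embed_coord[OF I]) (simp add: algebra_simps imag_unit_sq[OF I] imag_unit_sq'[OF I])

lemma slice_embed_coord2:
  assumes I: "I \<in> imag_units" and J: "J \<in> imag_units" "orthogonal I J"
  shows "slice_embed I (slice_coord2 I J q) = - (1/2) *\<^sub>R (q + I * q * I) * J"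
  unfolding slice_coord2_def
proof (rule slice_embed_coord[OF I])
  have "J * I = - (I * J)" by (rule imag_units_anticommute) fact+
  then have "(q + I * q * I) * J * I = - ((q + I * q * I) * I * J)"
    by (simp add: mult.assoc)
  also have "\<dots> = I * ((q + I * q * I) * J)"
    by (simp add: algebra_simps imag_unit_sq'[OF I])
  finally show "- (1/2) *\<^sub>R (q + I * q * I) * J * I = I * (- (1/2) *\<^sub>R (q + I * q * I) * J)"
    by simp
qed

lemma slice_coord_decomp:
  assumes I: "I \<in> imag_units" and J: "J \<in> imag_units" "orthogonal I J"
  shows "q = slice_embed I (slice_coord1 I q) + slice_embed I (slice_coord2 I J q) * J"
proof -
  have "- (1/2) *\<^sub>R (q + I * q * I) * J * J = (1/2) *\<^sub>R (q + I * q * I)"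
    by (simp add: mult.assoc imag_unit_sq[OF J(1)] del: scaleR_add_right scaleR_minus_right
        flip: scaleR_minus_right)
  moreover have "(1/2) *\<^sub>R (q - b) + (1/2) *\<^sub>R (q + b) = q" for b
    by (simp add: quat_eq_iff field_simps)
  ultimately show ?thesis
    unfolding slice_embed_coord1[OF I] slice_embed_coord2[OF I J] by presburger
qed

lemma bounded_linear_slice_coord1: "bounded_linear (slice_coord1 I)"
  unfolding slice_coord1_def
  by (intro bounded_linear_compose[OF bounded_linear_slice_coord] bounded_linear_const_scaleR
     bounded_linear_sub bounded_linear_mult_const bounded_linear_const_mult bounded_linear_ident)

lemma bounded_linear_slice_coord2: "bounded_linear (slice_coord2 I J)"
  unfolding slice_coord2_def
  by (intro bounded_linear_compose[OF bounded_linear_slice_coord] bounded_linear_const_scaleR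
     bounded_linear_add bounded_linear_mult_const bounded_linear_const_mult bounded_linear_ident)

lemma slice_coord1_mult:
  assumes I: "I \<in> imag_units"
  shows "slice_coord1 I (slice_embed I c * q) = c * slice_coord1 I q"
proof -
  have "slice_embed I (slice_coord1 I (slice_embed I c * q)) = slice_embed I (c * slice_coord1 I q)"
    unfolding slice_embed_mult[OF I] slice_embed_coord1[OF I]
    by (simp add: algebra_simps) (simp flip: mult.assoc add: slice_embed_commute_I[OF I])
  then show ?thesis by (simp add: slice_embed_eq_iff[OF I])
qed

lemma slice_coord2_mult:
  assumes I: "I \<in> imag_units" and J: "J \<in> imag_units" "orthogonal I J"
  shows "slice_coord2 I J (slice_embed I c * q) = c * slice_coord2 I J q"
proof -
  have "slice_embed I (slice_coord2 I J (slice_embed I c * q)) = slice_embed I (c * slice_coord2 I J q)"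
    unfolding slice_embed_mult[OF I] slice_embed_coord2[OF I J]
    by (simp add: algebra_simps) (simp flip: mult.assoc add: slice_embed_commute_I[OF I])
  then show ?thesis by (simp add: slice_embed_eq_iff[OF I])
qed

lemma norm_slice_coord1_le:
  assumes I: "I \<in> imag_units"
  shows "norm (slice_coord1 I q) \<le> norm q"
proof -
  have "norm (slice_coord1 I q) = norm (q - I * q * I) / 2"
    by (simp flip: norm_slice_embed[OF I] add: slice_embed_coord1[OF I])
  also have "\<dots> \<le> norm q"
    using norm_triangle_ineq4[of q "I * q * I"] by (simp add: norm_mult imag_unit_norm[OF I])
  finally show ?thesis .
qed

lemma norm_slice_coord2_le:
  assumes I: "I \<in> imag_units" and J: "J \<in> imag_units" "orthogonal I J"
  shows "norm (slice_coord2 I J q) \<le> norm q"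
proof -
  have "norm (slice_coord2 I J q) = norm (q + I * q * I) / 2"
    by (simp flip: norm_slice_embed[OF I] add: slice_embed_coord2[OF I J] norm_mult imag_unit_norm[OF J(1)])
  also have "\<dots> \<le> norm q"
    using norm_triangle_ineq[of q "I * q * I"] by (simp add: norm_mult imag_unit_norm[OF I])
  finally show ?thesis .
qed

lemma norm_le_slice_coords:
  assumes I: "I \<in> imag_units" and J: "J \<in> imag_units" "orthogonal I J"
  shows "norm q \<le> norm (slice_coord1 I q) + norm (slice_coord2 I J q)"
proof -
  have "norm q \<le> norm (slice_embed I (slice_coord1 I q)) + norm (slice_embed I (slice_coord2 I J q) * J)"
    by (subst slice_coord_decomp[OF I J, of q]) (rule norm_triangle_ineq)
  then show ?thesis
    by (simp add: norm_slice_embed[OF I] norm_mult imag_unit_norm[OF J(1)])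
qed

text \<open>
  In coordinate-free form, the Cauchy-Riemann equation says that the real derivative of \<open>f\<close> along the
  slice is \<open>w \<mapsto> w * d\<close> for one quaternion \<open>d\<close>.  This makes composition with maps that are linear for left
  multiplication by \<open>L_I\<close> immediate, so all later arguments use this form.
\<close>

lemma slice_holomorphic_iff:
  assumes I: "I \<in> imag_units"
  shows "slice_holomorphic_on I f W \<longleftrightarrow>
    (\<forall>z. slice_embed I z \<in> W \<longrightarrow>
      (\<exists>d. ((\<lambda>w. f (slice_embed I w)) has_derivative (\<lambda>w. slice_embed I w * d)) (at z)))"
proof -
  let ?g = "\<lambda>(s, t). f (of_real s + I * of_real t)"
  have conv: "(?g differentiable (at (x, y)) \<and> slice_dbar I f x y = 0) \<longleftrightarrow>
      (\<exists>d. ((\<lambda>w. f (slice_embed I w)) has_derivative (\<lambda>w. slice_embed I w * d)) (at (Complex x y)))"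
    (is "?L \<longleftrightarrow> ?R") for x y
  proof -
    have partials: "vector_derivative (\<lambda>s. f (of_real s + I * of_real y)) (at x) = D (1, 0)"
      "vector_derivative (\<lambda>t. f (of_real x + I * of_real t)) (at y) = D (0, 1)"
      if D: "(?g has_derivative D) (at (x, y))" for D
    proof -
      interpret D: bounded_linear D by (rule has_derivative_bounded_linear[OF D])
      have "((\<lambda>s. (s, y)) has_derivative (\<lambda>h. (h, 0))) (at x)"
        by (auto intro!: derivative_eq_intros)
      from has_derivative_compose[OF this D]
      have "((\<lambda>s. f (of_real s + I * of_real y)) has_derivative (\<lambda>h. D (h, 0))) (at x)"
        by simp
      moreover have "(\<lambda>h. D (h, 0)) = (\<lambda>h. h *\<^sub>R D (1, 0))"
      proof
        fix h
        have "h *\<^sub>R (1, 0) = ((h, 0) :: real \<times> real)" by simp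
        then show "D (h, 0) = h *\<^sub>R D (1, 0)" using D.scaleR by metis
      qed
      ultimately show "vector_derivative (\<lambda>s. f (of_real s + I * of_real y)) (at x) = D (1, 0)"
        by (intro vector_derivative_at) (simp only: has_vector_derivative_def)
      have "((\<lambda>t. (x, t)) has_derivative (\<lambda>h. (0, h))) (at y)"
        by (auto intro!: derivative_eq_intros)
      from has_derivative_compose[OF this D]
      have "((\<lambda>t. f (of_real x + I * of_real t)) has_derivative (\<lambda>h. D (0, h))) (at y)"
        by simp
      moreover have "(\<lambda>h. D (0, h)) = (\<lambda>h. h *\<^sub>R D (0, 1))"
      proof
        fix h
        have "h *\<^sub>R (0, 1) = ((0, h) :: real \<times> real)" by simp
        then show "D (0, h) = h *\<^sub>R D (0, 1)" using D.scaleR by metis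
      qed
      ultimately show "vector_derivative (\<lambda>t. f (of_real x + I * of_real t)) (at y) = D (0, 1)"
        by (intro vector_derivative_at) (simp only: has_vector_derivative_def)
    qed
    show ?thesis
    proof
      assume ?L
      then obtain D where D: "(?g has_derivative D) (at (x, y))" and db: "slice_dbar I f x y = 0"
        by (auto simp: differentiable_def)
      interpret D: bounded_linear D by (rule has_derivative_bounded_linear[OF D])
      have CR: "D (1, 0) + I * D (0, 1) = 0"
        using db by (simp add: slice_dbar_def partials[OF D])
      then have "I * (D (1, 0) + I * D (0, 1)) = 0" by simp
      then have CR': "D (0, 1) = I * D (1, 0)"
        by (simp add: distrib_left imag_unit_sq'[OF I])
      have "((\<lambda>w. (Re w, Im w)) has_derivative (\<lambda>w. (Re w, Im w))) (at (Complex x y))"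
        by (auto intro!: derivative_eq_intros)
      from has_derivative_compose[OF this, of ?g D] D
      have "((\<lambda>w. f (slice_embed I w)) has_derivative (\<lambda>w. D (Re w, Im w))) (at (Complex x y))"
        by (simp add: slice_embed_def)
      moreover have "D (Re w, Im w) = slice_embed I w * D (1, 0)" for w
      proof -
        have "D (Re w, Im w) = D (Re w *\<^sub>R (1, 0) + Im w *\<^sub>R (0, 1))" by simp
        also have "\<dots> = Re w *\<^sub>R D (1, 0) + Im w *\<^sub>R D (0, 1)"
          by (simp only: D.add D.scaleR)
        also have "\<dots> = slice_embed I w * D (1, 0)"
          by (simp add: CR' slice_embed_def distrib_right of_real_commute_quat)
            (simp add: scaleR_conv_of_real mult.assoc)
        finally show ?thesis .
      qed
      ultimately show ?R by auto
    next
      assume ?R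
      then obtain d where d: "((\<lambda>w. f (slice_embed I w)) has_derivative (\<lambda>w. slice_embed I w * d)) (at (Complex x y))"
        by blast
      have e: "(case p of (s, t) \<Rightarrow> Complex s t) = of_real (fst p) + \<i> * of_real (snd p)" for p
        by (simp add: case_prod_beta complex_eq_iff)
      have "((\<lambda>p. case p of (s, t) \<Rightarrow> Complex s t) has_derivative (\<lambda>p. case p of (s, t) \<Rightarrow> Complex s t)) (at (x, y))"
        unfolding e by (auto intro!: derivative_eq_intros)
      from has_derivative_compose[OF this, of "\<lambda>w. f (slice_embed I w)" "\<lambda>w. slice_embed I w * d"] d
      have "((\<lambda>p. f (slice_embed I (case p of (s, t) \<Rightarrow> Complex s t))) has_derivative
          (\<lambda>p. slice_embed I (case p of (s, t) \<Rightarrow> Complex s t) * d)) (at (x, y))"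
        by simp
      then have D: "(?g has_derivative (\<lambda>p. slice_embed I (case p of (s, t) \<Rightarrow> Complex s t) * d)) (at (x, y))"
        by (simp add: slice_embed_def case_prod_unfold)
      have "slice_dbar I f x y = 0"
        unfolding slice_dbar_def partials[OF D]
        by (simp add: slice_embed_def imag_unit_sq'[OF I])
      with D show ?L by (auto simp: differentiable_def)
    qed
  qed
  have all: "(\<forall>z. P z) \<longleftrightarrow> (\<forall>x y. P (Complex x y))" for P
    by (metis complex.collapse)
  show ?thesis
    unfolding slice_holomorphic_on_def conv by (subst all) (simp add: slice_embed_def)
qed

section \<open>Slice regular functions and the representation formula\<close>

lemma slice_regular_on_iff:
  "slice_regular_on f \<Omega> \<longleftrightarrow> (\<forall>I\<in>imag_units. \<forall>z. slice_embed I z \<in> \<Omega> \<longrightarrow>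
     (\<exists>d. ((\<lambda>w. f (slice_embed I w)) has_derivative (\<lambda>w. slice_embed I w * d)) (at z)))"
  by (simp add: slice_regular_on_def slice_holomorphic_iff slice_plane_eq_range)

lemma continuous_slice_embed: "continuous_on A (slice_embed I)"
  by (rule bounded_linear.continuous_on[OF bounded_linear_slice_embed continuous_on_id])

lemma open_slice_vimage: "open \<Omega> \<Longrightarrow> open (slice_embed I -` \<Omega>)"
  by (rule open_vimage[OF _ continuous_slice_embed])

lemma connected_slice_vimage:
  assumes "slice_domain \<Omega>" and I: "I \<in> imag_units"
  shows "connected (slice_embed I -` \<Omega>)"
proof -
  have "slice_embed I -` \<Omega> = slice_coord I ` (\<Omega> \<inter> slice_plane I)"
    by (force simp: slice_plane_eq_range slice_coord_embed[OF I])
  moreover have "connected (\<Omega> \<inter> slice_plane I)"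
    using assms by (simp add: slice_domain_def)
  ultimately show ?thesis
    using bounded_linear.continuous_on[OF bounded_linear_slice_coord continuous_on_id]
    by (metis connected_continuous_image)
qed

lemma symmetric_set_slice_embed:
  assumes "symmetric_set \<Omega>" "slice_embed I z \<in> \<Omega>" "I \<in> imag_units" "J \<in> imag_units"
  shows "slice_embed J z \<in> \<Omega>" "slice_embed J (cnj z) \<in> \<Omega>"
proof -
  have "sphere_at (Re z) (Im z) \<subseteq> \<Omega>"
    using assms unfolding symmetric_set_def slice_embed_def by blast
  moreover have "slice_embed J z \<in> sphere_at (Re z) (Im z)"
    using assms by (auto simp: sphere_at_def slice_embed_def of_real_commute_quat)
  moreover have "slice_embed J (cnj z) = of_real (Re z) + of_real (Im z) * (- J)"
    by (simp add: slice_embed_def of_real_commute_quat)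
  then have "slice_embed J (cnj z) \<in> sphere_at (Re z) (Im z)"
    unfolding sphere_at_def using uminus_imag_unit[OF assms(4)] by blast
  ultimately show "slice_embed J z \<in> \<Omega>" "slice_embed J (cnj z) \<in> \<Omega>"
    by blast+
qed

lemma slice_regular_on_cong:
  assumes "open \<Omega>" "\<And>q. q \<in> \<Omega> \<Longrightarrow> f q = g q" "slice_regular_on f \<Omega>"
  shows "slice_regular_on g \<Omega>"
  unfolding slice_regular_on_iff
proof (intro ballI allI impI)
  fix I z assume I: "I \<in> imag_units" and z: "slice_embed I z \<in> \<Omega>"
  then obtain d where d: "((\<lambda>w. f (slice_embed I w)) has_derivative (\<lambda>w. slice_embed I w * d)) (at z)"
    using assms(3) by (auto simp: slice_regular_on_iff)
  have "((\<lambda>w. g (slice_embed I w)) has_derivative (\<lambda>w. slice_embed I w * d)) (at z)"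
    by (rule has_derivative_transform_within_open[OF d open_slice_vimage[OF assms(1)]])
      (use z assms(2) in auto)
  then show "\<exists>d. ((\<lambda>w. g (slice_embed I w)) has_derivative (\<lambda>w. slice_embed I w * d)) (at z)"
    by blast
qed

lemma holomorphic_slice_coord1:
  assumes "slice_regular_on f \<Omega>" and I: "I \<in> imag_units"
  shows "(\<lambda>z. slice_coord1 I (f (slice_embed I z))) holomorphic_on (slice_embed I -` \<Omega>)"
proof -
  have "(\<lambda>z. slice_coord1 I (f (slice_embed I z))) field_differentiable at z within (slice_embed I -` \<Omega>)"
    if z: "slice_embed I z \<in> \<Omega>" for z
  proof -
    obtain d where d: "((\<lambda>w. f (slice_embed I w)) has_derivative (\<lambda>w. slice_embed I w * d)) (at z)"
      using assms z unfolding slice_regular_on_iff by blast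
    have "((\<lambda>w. slice_coord1 I (f (slice_embed I w))) has_derivative
        (\<lambda>w. slice_coord1 I (slice_embed I w * d))) (at z)"
      by (rule bounded_linear.has_derivative[OF bounded_linear_slice_coord1 d])
    then have "((\<lambda>w. slice_coord1 I (f (slice_embed I w))) has_field_derivative (slice_coord1 I d)) (at z)"
      by (simp add: has_field_derivative_def slice_coord1_mult[OF I] mult_commute_abs)
    then show ?thesis
      using field_differentiable_def field_differentiable_at_within by blast
  qed
  then show ?thesis by (auto simp: holomorphic_on_def)
qed

lemma holomorphic_slice_coord2:
  assumes "slice_regular_on f \<Omega>" and I: "I \<in> imag_units" and J: "J \<in> imag_units" "orthogonal I J"
  shows "(\<lambda>z. slice_coord2 I J (f (slice_embed I z))) holomorphic_on (slice_embed I -` \<Omega>)"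
proof -
  have "(\<lambda>z. slice_coord2 I J (f (slice_embed I z))) field_differentiable at z within (slice_embed I -` \<Omega>)"
    if z: "slice_embed I z \<in> \<Omega>" for z
  proof -
    obtain d where d: "((\<lambda>w. f (slice_embed I w)) has_derivative (\<lambda>w. slice_embed I w * d)) (at z)"
      using assms z unfolding slice_regular_on_iff by blast
    have "((\<lambda>w. slice_coord2 I J (f (slice_embed I w))) has_derivative
        (\<lambda>w. slice_coord2 I J (slice_embed I w * d))) (at z)"
      by (rule bounded_linear.has_derivative[OF bounded_linear_slice_coord2 d])
    then have "((\<lambda>w. slice_coord2 I J (f (slice_embed I w))) has_field_derivative (slice_coord2 I J d)) (at z)"
      by (simp add: has_field_derivative_def slice_coord2_mult[OF I J] mult_commute_abs)
    then show ?thesis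
      using field_differentiable_def field_differentiable_at_within by blast
  qed
  then show ?thesis by (auto simp: holomorphic_on_def)
qed

lemma slice_coords_eq_iff:
  assumes I: "I \<in> imag_units" and J: "J \<in> imag_units" "orthogonal I J"
  shows "p = q \<longleftrightarrow> slice_coord1 I p = slice_coord1 I q \<and> slice_coord2 I J p = slice_coord2 I J q"
  using slice_coord_decomp[OF assms] by metis

text \<open>
  A slice domain contains a real interval.  Every slice of it is connected and contains that interval, so
  the identity theorem, applied to the two complex coordinates, propagates equality from the interval to
  each slice.
\<close>

lemma slice_regular_identity_real:
  assumes \<Omega>: "slice_domain \<Omega>" and f: "slice_regular_on f \<Omega>" and g: "slice_regular_on g \<Omega>"
    and eq: "\<And>x. of_real x \<in> \<Omega> \<Longrightarrow> f (of_real x) = g (of_real x)" and q: "q \<in> \<Omega>"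
  shows "f q = g q"
proof -
  obtain I x y where I: "I \<in> imag_units" and "q = of_real x + I * of_real y"
    using ex_imag_unit_form[of q] by blast
  then have qe: "q = slice_embed I (Complex x y)" by (simp add: slice_embed_def)
  obtain J where J: "J \<in> imag_units" "orthogonal I J"
    using ex_orthogonal_imag_unit[OF I] by blast
  let ?D = "slice_embed I -` \<Omega>"
  have D: "open ?D" "connected ?D"
    using \<Omega> I connected_slice_vimage by (auto simp: slice_domain_def open_slice_vimage)
  from \<Omega> obtain x0 where x0: "of_real x0 \<in> \<Omega>"
    by (auto simp: slice_domain_def Reals_def)
  then have x0D: "complex_of_real x0 \<in> ?D" by (simp add: slice_embed_of_real)
  then obtain r where r: "r > 0" "ball (complex_of_real x0) r \<subseteq> ?D"
    using D(1) open_contains_ball by blast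
  let ?U = "{z \<in> ?D. z \<in> \<real>}"
  have lim: "complex_of_real x0 islimpt ?U"
    unfolding islimpt_approachable
  proof (intro allI impI)
    fix e :: real assume e: "e > 0"
    let ?w = "complex_of_real (x0 + min e r / 2)"
    have d: "dist ?w (complex_of_real x0) = min e r / 2"
      using e r by (simp add: dist_norm)
    then have "?w \<in> ball (complex_of_real x0) r"
      using e r by (simp add: dist_commute)
    then have "?w \<in> ?U" using r by auto
    moreover have "?w \<noteq> of_real x0" using e r by auto
    moreover have "dist ?w (of_real x0) < e" unfolding d using e r by linarith
    ultimately show "\<exists>w\<in>?U. w \<noteq> of_real x0 \<and> dist w (of_real x0) < e" by blast
  qed
  have agree: "f (slice_embed I z) = g (slice_embed I z)" if "z \<in> ?U" for z
    using that eq by (auto simp: slice_embed_of_real elim!: Reals_cases)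
  have w: "Complex x y \<in> ?D" using q qe by simp
  have "slice_coord1 I (f q) - slice_coord1 I (g q) = 0"
    unfolding qe
    by (rule analytic_continuation[OF _ D _ x0D lim _ w, where f = "\<lambda>z. slice_coord1 I (f (slice_embed I z)) - slice_coord1 I (g (slice_embed I z))"])
      (auto intro!: holomorphic_intros holomorphic_slice_coord1 f g I simp: agree)
  moreover have "slice_coord2 I J (f q) - slice_coord2 I J (g q) = 0"
    unfolding qe
    by (rule analytic_continuation[OF _ D _ x0D lim _ w, where f = "\<lambda>z. slice_coord2 I J (f (slice_embed I z)) - slice_coord2 I J (g (slice_embed I z))"])
      (auto intro!: holomorphic_intros holomorphic_slice_coord2 f g I J simp: agree)
  ultimately show ?thesis
    by (simp add: slice_coords_eq_iff[OF I J, of "f q"])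
qed

text \<open>
  The right-hand side of the representation formula, that is, the extension of a function on the slice
  \<open>L_I\<close> to the whole symmetric domain.  The choice of \<open>(J, z)\<close> is immaterial, as the formula is
  invariant under \<open>(J, z) \<mapsto> (- J, cnj z)\<close>.
\<close>

definition slice_extend :: "quat \<Rightarrow> (quat \<Rightarrow> quat) \<Rightarrow> quat \<Rightarrow> quat" where
  "slice_extend I h q =
     (case (SOME (J, z). J \<in> imag_units \<and> q = slice_embed J z) of (J, z) \<Rightarrow>
       (1/2) *\<^sub>R ((h (slice_embed I z) + h (slice_embed I (cnj z))) +
         J * (I * (h (slice_embed I (cnj z)) - h (slice_embed I z)))))"

text \<open>
  The pair \<open>(J, z)\<close> is determined by the point up to simultaneous sign change, except that \<open>J\<close> is
  arbitrary at real points.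
\<close>

lemma slice_embed_eq_cases:
  assumes J: "J \<in> imag_units" and K: "K \<in> imag_units" and eq: "slice_embed J z = slice_embed K w"
  obtains "z = w" "J = K" | "w = cnj z" "K = - J" | "w = z" "cnj z = z"
proof -
  have re: "Re z = Re w"
    using eq J K unfolding quat_eq_iff by (simp add: slice_embed_def imag_units_iff)
  then have im: "J * of_real (Im z) = K * of_real (Im w)"
    using eq by (simp add: slice_embed_def)
  have "\<bar>Im z\<bar> = \<bar>Im w\<bar>"
    using arg_cong[OF im, of norm] by (simp add: norm_mult imag_unit_norm[OF J] imag_unit_norm[OF K])
  then consider "Im z = 0" "Im w = 0" | "Im z \<noteq> 0" "Im w = Im z" | "Im z \<noteq> 0" "Im w = - Im z"
    by linarith
  then show thesis
  proof cases
    case 1 then show ?thesis using that(3) re by (simp add: complex_eq_iff)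
  next
    case 2 then show ?thesis using that(1) re im by (simp add: complex_eq_iff)
  next
    case 3
    then have "(J + K) * of_real (Im z) = 0" using im by (simp add: algebra_simps)
    then have "K = - J" using 3 by (simp add: add_eq_0_iff)
    then show ?thesis using that(2) re 3 by (simp add: complex_eq_iff)
  qed
qed

lemma slice_extend_embed:
  assumes J: "J \<in> imag_units"
  shows "slice_extend I h (slice_embed J z) =
    (1/2) *\<^sub>R ((h (slice_embed I z) + h (slice_embed I (cnj z))) +
         J * (I * (h (slice_embed I (cnj z)) - h (slice_embed I z))))"
proof -
  obtain K w where Kw: "(SOME (K, w). K \<in> imag_units \<and> slice_embed J z = slice_embed K w) = (K, w)"
    by fastforce
  have "case (SOME (K, w). K \<in> imag_units \<and> slice_embed J z = slice_embed K w) of (K, w) \<Rightarrow>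
      K \<in> imag_units \<and> slice_embed J z = slice_embed K w"
    by (rule someI[of _ "(J, z)"]) (simp add: J)
  then have K: "K \<in> imag_units" and eq: "slice_embed J z = slice_embed K w"
    by (simp_all add: Kw)
  show ?thesis
    unfolding slice_extend_def Kw prod.case
    by (rule slice_embed_eq_cases[OF J K eq]) (auto simp: algebra_simps)
qed

lemma slice_extend_same:
  assumes I: "I \<in> imag_units"
  shows "slice_extend I h (slice_embed I z) = h (slice_embed I z)"
  unfolding slice_extend_embed[OF I] imag_unit_sq'[OF I]
  by (simp add: scaleR_2[symmetric])

text \<open>
  If \<open>d1\<close> and \<open>d2\<close> are the derivatives of \<open>h\<close> at \<open>z\<close> and at \<open>cnj z\<close>, then the derivative of the
  extension on the slice \<open>L_J\<close> is obtained by putting them into the same formula that defines the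
  extension.
\<close>

lemma slice_extend_regular:
  assumes \<Omega>: "symmetric_set \<Omega>" and I: "I \<in> imag_units"
    and h: "\<And>z. slice_embed I z \<in> \<Omega> \<Longrightarrow>
      \<exists>d. ((\<lambda>w. h (slice_embed I w)) has_derivative (\<lambda>w. slice_embed I w * d)) (at z)"
  shows "slice_regular_on (slice_extend I h) \<Omega>"
  unfolding slice_regular_on_iff
proof (intro ballI allI impI)
  fix J z assume J: "J \<in> imag_units" and z: "slice_embed J z \<in> \<Omega>"
  obtain d1 where d1: "((\<lambda>w. h (slice_embed I w)) has_derivative (\<lambda>w. slice_embed I w * d1)) (at z)"
    using h symmetric_set_slice_embed[OF \<Omega> z J I] by blast
  obtain d2 where d2: "((\<lambda>w. h (slice_embed I w)) has_derivative (\<lambda>w. slice_embed I w * d2)) (at (cnj z))"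
    using h symmetric_set_slice_embed[OF \<Omega> z J I] by blast
  have "(cnj has_derivative cnj) (at z)"
    using bounded_linear_cnj bounded_linear_imp_has_derivative by blast
  from has_derivative_compose[OF this d2]
  have d2': "((\<lambda>w. h (slice_embed I (cnj w))) has_derivative (\<lambda>w. slice_embed I (cnj w) * d2)) (at z)" .
  let ?d = "(1/2) *\<^sub>R ((d1 + d2) + J * (I * (d2 - d1)))"
  have "((\<lambda>w. slice_extend I h (slice_embed J w)) has_derivative
     (\<lambda>w. (1/2) *\<^sub>R ((slice_embed I w * d1 + slice_embed I (cnj w) * d2) +
         J * (I * (slice_embed I (cnj w) * d2 - slice_embed I w * d1))))) (at z)"
    unfolding slice_extend_embed[OF J]
    by (intro has_derivative_scaleR_right has_derivative_add has_derivative_mult_right has_derivative_diff d1 d2')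
  moreover have "(1/2) *\<^sub>R ((slice_embed I w * d1 + slice_embed I (cnj w) * d2) +
         J * (I * (slice_embed I (cnj w) * d2 - slice_embed I w * d1))) = slice_embed J w * ?d" for w
  proof -
    have "(slice_embed I w * d1 + slice_embed I (cnj w) * d2) +
         J * (I * (slice_embed I (cnj w) * d2 - slice_embed I w * d1)) =
       slice_embed J w * ((d1 + d2) + J * (I * (d2 - d1)))"
      by (simp add: slice_embed_def algebra_simps imag_unit_sq'[OF I] imag_unit_sq'[OF J]
          of_real_def)
    then show ?thesis by simp
  qed
  ultimately show "\<exists>d. ((\<lambda>w. slice_extend I h (slice_embed J w)) has_derivative
      (\<lambda>w. slice_embed J w * d)) (at z)"
    by (intro exI[of _ ?d]) (simp only:)
qed

text \<open>
  The extension of the restriction to \<open>L_I\<close> is regular and agrees with \<open>f\<close> on \<open>L_I\<close>, in particular at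
  real points.
\<close>

lemma representation_formula:
  assumes \<Omega>: "slice_domain \<Omega>" "symmetric_set \<Omega>" and f: "slice_regular_on f \<Omega>"
    and I: "I \<in> imag_units" and q: "q \<in> \<Omega>"
  shows "f q = slice_extend I f q"
proof (rule slice_regular_identity_real[OF \<Omega>(1) f _ _ q])
  show "slice_regular_on (slice_extend I f) \<Omega>"
    using f I by (intro slice_extend_regular \<Omega>) (auto simp: slice_regular_on_iff)
  show "f (of_real x) = slice_extend I f (of_real x)" for x
    using slice_extend_same[OF I, of f "of_real x"] by (simp add: slice_embed_of_real)
qed

lemma slice_regular_eqI:
  assumes \<Omega>: "slice_domain \<Omega>" "symmetric_set \<Omega>"
    and f: "slice_regular_on f \<Omega>" and g: "slice_regular_on g \<Omega>" and I: "I \<in> imag_units"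
    and eq: "\<And>z. slice_embed I z \<in> \<Omega> \<Longrightarrow> f (slice_embed I z) = g (slice_embed I z)" and q: "q \<in> \<Omega>"
  shows "f q = g q"
proof -
  obtain J x y where J: "J \<in> imag_units" and "q = of_real x + J * of_real y"
    using ex_imag_unit_form[of q] by blast
  then have qe: "q = slice_embed J (Complex x y)" by (simp add: slice_embed_def)
  show ?thesis
    unfolding representation_formula[OF \<Omega> f I q] representation_formula[OF \<Omega> g I q]
    unfolding qe slice_extend_embed[OF J]
    using symmetric_set_slice_embed[OF \<Omega>(2) _ J I, of "Complex x y"] q qe
    by (simp add: eq)
qed

text \<open>
  On a sphere \<open>x + y \<S>\<close> a regular function is affine in the imaginary unit.
\<close>

lemma slice_regular_stem:
  assumes \<Omega>: "slice_domain \<Omega>" "symmetric_set \<Omega>" and g: "slice_regular_on g \<Omega>"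
    and "L \<in> imag_units" "slice_embed L z \<in> \<Omega>"
  obtains a b where "\<And>K. K \<in> imag_units \<Longrightarrow> g (slice_embed K z) = a + K * b"
    "\<And>K. K \<in> imag_units \<Longrightarrow> g (slice_embed K (cnj z)) = a - K * b"
proof
  fix K assume K: "K \<in> imag_units"
  have mem: "slice_embed K z \<in> \<Omega>" "slice_embed K (cnj z) \<in> \<Omega>"
    using symmetric_set_slice_embed[OF \<Omega>(2) assms(5,4) K] by auto
  let ?a = "(1/2) *\<^sub>R (g (slice_embed L z) + g (slice_embed L (cnj z)))"
  let ?b = "(1/2) *\<^sub>R (L * (g (slice_embed L (cnj z)) - g (slice_embed L z)))"
  show "g (slice_embed K z) = ?a + K * ?b"
    unfolding representation_formula[OF \<Omega> g assms(4) mem(1)] slice_extend_embed[OF K]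
    by (simp add: scaleR_add_right)
  show "g (slice_embed K (cnj z)) = ?a - K * ?b"
    unfolding representation_formula[OF \<Omega> g assms(4) mem(2)] slice_extend_embed[OF K]
    by (simp add: algebra_simps)
qed

section \<open>The regular product with a linear factor and difference quotients\<close>

lemma slice_splitting_coords:
  assumes f: "slice_regular_on f \<Omega>" and K: "K \<in> imag_units" and J: "J \<in> imag_units" "orthogonal K J"
  shows "slice_splitting \<Omega> K J f (\<lambda>q. slice_embed K (slice_coord1 K (f q)))
           (\<lambda>q. slice_embed K (slice_coord2 K J (f q)))"
  unfolding slice_splitting_def slice_holomorphic_iff[OF K]
proof (intro conjI allI impI ballI)
  fix z assume "slice_embed K z \<in> \<Omega> \<inter> slice_plane K"
  then obtain d where d: "((\<lambda>w. f (slice_embed K w)) has_derivative (\<lambda>w. slice_embed K w * d)) (at z)"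
    using f K unfolding slice_regular_on_iff by blast
  have "((\<lambda>w. slice_embed K (slice_coord1 K (f (slice_embed K w)))) has_derivative
      (\<lambda>w. slice_embed K (slice_coord1 K (slice_embed K w * d)))) (at z)"
    by (intro bounded_linear.has_derivative[OF bounded_linear_slice_embed]
        bounded_linear.has_derivative[OF bounded_linear_slice_coord1] d)
  then show "\<exists>d. ((\<lambda>w. slice_embed K (slice_coord1 K (f (slice_embed K w)))) has_derivative
      (\<lambda>w. slice_embed K w * d)) (at z)"
    unfolding slice_coord1_mult[OF K] slice_embed_mult[OF K] by blast
  have "((\<lambda>w. slice_embed K (slice_coord2 K J (f (slice_embed K w)))) has_derivative
      (\<lambda>w. slice_embed K (slice_coord2 K J (slice_embed K w * d)))) (at z)"
    by (intro bounded_linear.has_derivative[OF bounded_linear_slice_embed]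
        bounded_linear.has_derivative[OF bounded_linear_slice_coord2] d)
  then show "\<exists>d. ((\<lambda>w. slice_embed K (slice_coord2 K J (f (slice_embed K w)))) has_derivative
      (\<lambda>w. slice_embed K w * d)) (at z)"
    unfolding slice_coord2_mult[OF K J] slice_embed_mult[OF K] by blast
next
  fix z
  show "f z = slice_embed K (slice_coord1 K (f z)) + slice_embed K (slice_coord2 K J (f z)) * J"
    by (rule slice_coord_decomp[OF K J])
qed (auto simp: slice_plane_eq_range)

lemma imag_unit_conj_slice:
  assumes K: "K \<in> imag_units" and J: "J \<in> imag_units" "orthogonal K J" and a: "a \<in> slice_plane K"
  shows "J * a = qcnj a * J"
proof -
  obtain u where u: "a = slice_embed K u"
    using a by (auto simp: slice_plane_eq_range)
  show ?thesis
    unfolding u slice_embed_cnj[OF K, symmetric]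
  proof -
    have "J * slice_embed K u = of_real (Re u) * J + J * K * of_real (Im u)"
      by (simp add: slice_embed_def distrib_left mult.assoc of_real_commute_quat[of J])
    also have "\<dots> = of_real (Re u) * J - K * (J * of_real (Im u))"
      unfolding imag_units_anticommute[OF K J] by (simp add: mult.assoc)
    also have "\<dots> = slice_embed K (cnj u) * J"
      unfolding of_real_commute_quat[of J] by (simp add: slice_embed_def algebra_simps)
    finally show "J * slice_embed K u = slice_embed K (cnj u) * J" .
  qed
qed

text \<open>
  The product in a splitting can be written without \<open>J\<close>: it is \<open>F(z) g(z) + G(z) J g(cnj z)\<close>, because
  \<open>J\<close> conjugates \<open>L_I\<close>, and \<open>F\<close> and \<open>G J\<close> are the parts of \<open>f\<close> that commute and anticommute with the
  imaginary unit.  This shows independence of \<open>J\<close>.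
\<close>

lemma splitting_product:
  assumes K: "K \<in> imag_units" and J: "J \<in> imag_units" "orthogonal K J"
    and f: "slice_splitting \<Omega> K J f F G" and g: "slice_splitting \<Omega> K J g H L"
    and z: "z \<in> \<Omega> \<inter> slice_plane K" "qcnj z \<in> \<Omega> \<inter> slice_plane K"
  shows "(F z * H z - G z * qcnj (L (qcnj z))) + (F z * L z + G z * qcnj (H (qcnj z))) * J =
    (1/2) *\<^sub>R (f z - K * f z * K) * g z + (1/2) *\<^sub>R (f z + K * f z * K) * g (qcnj z)"
proof -
  have fz: "f z = F z + G z * J" and gz: "g z = H z + L z * J"
    and gz': "g (qcnj z) = H (qcnj z) + L (qcnj z) * J"
    and mem: "F z \<in> slice_plane K" "G z \<in> slice_plane K" "H (qcnj z) \<in> slice_plane K" "L (qcnj z) \<in> slice_plane K"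
    using f g z by (auto simp: slice_splitting_def)
  have comm: "K * a * K = - a" if "a \<in> slice_plane K" for a
  proof -
    have "K * a = a * K"
      using that by (auto simp: slice_plane_eq_range slice_embed_commute_I[OF K])
    then show ?thesis
      using imag_unit_sq[OF K] by (simp add: mult.assoc)
  qed
  have "K * (G z * J) * K = - (K * G z * K * J)"
    using imag_units_anticommute[OF K J] by (simp add: mult.assoc)
  then have KK: "K * f z * K = - F z + G z * J"
    unfolding fz distrib_left distrib_right comm[OF mem(1)] comm[OF mem(2)] by simp
  have half: "(1/2) *\<^sub>R (a + a) = a" for a :: quat
    by (simp flip: scaleR_2)
  have "(1/2) *\<^sub>R (f z - K * f z * K) = (1/2) *\<^sub>R (F z + F z)"
    unfolding KK by (simp add: fz)
  then have e1: "(1/2) *\<^sub>R (f z - K * f z * K) = F z"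
    unfolding half .
  have "(1/2) *\<^sub>R (f z + K * f z * K) = (1/2) *\<^sub>R (G z * J + G z * J)"
    unfolding KK by (simp add: fz)
  then have e2: "(1/2) *\<^sub>R (f z + K * f z * K) = G z * J"
    unfolding half .
  have "J * g (qcnj z) = J * H (qcnj z) + J * L (qcnj z) * J"
    unfolding gz' by (simp add: distrib_left mult.assoc)
  also have "\<dots> = qcnj (H (qcnj z)) * J - qcnj (L (qcnj z))"
    unfolding imag_unit_conj_slice[OF K J mem(3)] imag_unit_conj_slice[OF K J mem(4)]
    by (simp add: mult.assoc imag_unit_sq[OF J(1)])
  finally have e3: "J * g (qcnj z) = qcnj (H (qcnj z)) * J - qcnj (L (qcnj z))" .
  show ?thesis
    unfolding e1 e2 mult.assoc[of "G z" J] e3 gz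
    by (simp add: algebra_simps)
qed

text \<open>
  Independence of the slice: extending \<open>(q - q0) g(q)\<close> from a slice through \<open>q0\<close> gives on every other
  slice the value that the product formula prescribes there.  If \<open>g = a + K b\<close> on the sphere, both sides
  are \<open>f a + K f b\<close>.
\<close>

lemma slice_stem_product:
  assumes I: "I \<in> imag_units" and K: "K \<in> imag_units" and q0: "q0 * I = I * q0"
    and g: "\<And>K. K \<in> imag_units \<Longrightarrow> g (slice_embed K z) = a + K * b"
      "\<And>K. K \<in> imag_units \<Longrightarrow> g (slice_embed K (cnj z)) = a - K * b"
  defines "f \<equiv> slice_embed K z - q0"
  shows "slice_extend I (\<lambda>q. (q - q0) * g q) (slice_embed K z) =
    (1/2) *\<^sub>R (f - K * f * K) * g (slice_embed K z) + (1/2) *\<^sub>R (f + K * f * K) * g (slice_embed K (cnj z))"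
proof -
  have two: "(1/2) *\<^sub>R p = q" if "p = q + q" for p q :: quat
    using that by (simp flip: scaleR_2)
  have q0': "I * (q0 * x) = q0 * (I * x)" for x
    using q0 by (metis mult.assoc)
  have comm: "I * (of_real r * x) = of_real r * (I * x)" "K * (of_real r * x) = of_real r * (K * x)"
    "q0 * (of_real r * x) = of_real r * (q0 * x)" for r x
    by (simp_all add: quat_eq_iff algebra_simps)
  have "slice_extend I (\<lambda>q. (q - q0) * g q) (slice_embed K z) = f * a + K * (f * b)"
    unfolding slice_extend_embed[OF K] g[OF I]
    by (rule two) (simp add: f_def slice_embed_def algebra_simps comm q0' imag_unit_sq'[OF I] imag_unit_sq'[OF K])
  moreover have "(1/2) *\<^sub>R ((f - K * f * K) * (a + K * b) + (f + K * f * K) * (a - K * b)) = f * a + K * (f * b)"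
    by (rule two) (simp add: algebra_simps imag_unit_sq'[OF K])
  ultimately show ?thesis
    unfolding g[OF K] mult_scaleR_left by (simp only: scaleR_add_right)
qed

lemma slice_regular_translation: "slice_regular_on (\<lambda>p. p - q0) \<Omega>"
  unfolding slice_regular_on_iff
proof (intro ballI allI impI)
  fix I z
  have "((\<lambda>w. slice_embed I w - q0) has_derivative (\<lambda>w. slice_embed I w * 1)) (at z)"
    by (auto intro!: derivative_eq_intros bounded_linear_imp_has_derivative bounded_linear_slice_embed)
  then show "\<exists>d. ((\<lambda>w. slice_embed I w - q0) has_derivative (\<lambda>w. slice_embed I w * d)) (at z)"
    by blast
qed

text \<open>
  On a slice through \<open>q0\<close> the factor \<open>p - q0\<close> takes values in the slice, and the regular product is
  pointwise there.
\<close>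

lemma regular_product_translation:
  assumes \<Omega>: "slice_domain \<Omega>" "symmetric_set \<Omega>" and g: "slice_regular_on g \<Omega>"
    and I: "I \<in> imag_units" and q0: "q0 \<in> slice_plane I"
  shows "slice_regular_on (regular_product \<Omega> (\<lambda>p. p - q0) g) \<Omega>"
    and "slice_embed I z \<in> \<Omega> \<Longrightarrow> regular_product \<Omega> (\<lambda>p. p - q0) g (slice_embed I z) =
      (slice_embed I z - q0) * g (slice_embed I z)"
proof -
  obtain w0 where w0: "q0 = slice_embed I w0" using q0 by (auto simp: slice_plane_eq_range)
  have comm: "q0 * I = I * q0" unfolding w0 by (simp add: slice_embed_commute_I[OF I])
  have op: "open \<Omega>" using \<Omega> by (simp add: slice_domain_def)
  define h where "h = (\<lambda>q. if q \<in> \<Omega> then slice_extend I (\<lambda>q. (q - q0) * g q) q else 0)"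
  have "slice_regular_on (slice_extend I (\<lambda>q. (q - q0) * g q)) \<Omega>"
  proof (rule slice_extend_regular[OF \<Omega>(2) I])
    fix z assume "slice_embed I z \<in> \<Omega>"
    then obtain d where d: "((\<lambda>w. g (slice_embed I w)) has_derivative (\<lambda>w. slice_embed I w * d)) (at z)"
      using g I unfolding slice_regular_on_iff by blast
    have "((\<lambda>w. slice_embed I (w - w0) * g (slice_embed I w)) has_derivative
      (\<lambda>w. slice_embed I (z - w0) * (slice_embed I w * d) + slice_embed I w * g (slice_embed I z))) (at z)"
      by (rule has_derivative_mult[OF _ d])
        (auto intro!: derivative_eq_intros bounded_linear.has_derivative[OF bounded_linear_slice_embed])
    moreover have "slice_embed I (z - w0) * (slice_embed I w * d) + slice_embed I w * g (slice_embed I z) =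
       slice_embed I w * (slice_embed I (z - w0) * d + g (slice_embed I z))" for w
      by (metis distrib_left mult.assoc slice_embed_commute[OF I])
    ultimately show "\<exists>d. ((\<lambda>w. (slice_embed I w - q0) * g (slice_embed I w)) has_derivative
        (\<lambda>w. slice_embed I w * d)) (at z)"
      unfolding w0 slice_embed_diff[symmetric] by auto
  qed
  then have h_reg: "slice_regular_on h \<Omega>"
    by (rule slice_regular_on_cong[OF op, rotated]) (simp add: h_def)
  have h_formula: "(F (slice_embed K z) * H (slice_embed K z) - G (slice_embed K z) * qcnj (L (qcnj (slice_embed K z)))) +
      (F (slice_embed K z) * L (slice_embed K z) + G (slice_embed K z) * qcnj (H (qcnj (slice_embed K z)))) * J = h (slice_embed K z)"
    if K: "K \<in> imag_units" and J: "J \<in> imag_units" "orthogonal K J" and z: "slice_embed K z \<in> \<Omega>"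
      and F: "slice_splitting \<Omega> K J (\<lambda>p. p - q0) F G" and H: "slice_splitting \<Omega> K J g H L"
    for K J F G H L z
  proof -
    obtain a b where ab: "\<And>K. K \<in> imag_units \<Longrightarrow> g (slice_embed K z) = a + K * b"
      "\<And>K. K \<in> imag_units \<Longrightarrow> g (slice_embed K (cnj z)) = a - K * b"
      using slice_regular_stem[OF \<Omega> g K z] by blast
    have "slice_embed K (cnj z) \<in> \<Omega>"
      using symmetric_set_slice_embed[OF \<Omega>(2) z K K] by simp
    then have mem: "slice_embed K z \<in> \<Omega> \<inter> slice_plane K" "qcnj (slice_embed K z) \<in> \<Omega> \<inter> slice_plane K"
      using z by (auto simp: slice_plane_eq_range slice_embed_cnj[OF K, symmetric])
    show ?thesis
      unfolding splitting_product[OF K J F H mem]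
      using slice_stem_product[OF I K comm ab] z by (simp add: h_def slice_embed_cnj[OF K])
  qed
  have "regular_product \<Omega> (\<lambda>p. p - q0) g = h"
    unfolding regular_product_def
  proof (rule the_equality, intro conjI)
    obtain J where J: "J \<in> imag_units" "orthogonal I J"
      using ex_orthogonal_imag_unit[OF I] by blast
    let ?F = "\<lambda>q. slice_embed I (slice_coord1 I (q - q0))" and ?G = "\<lambda>q. slice_embed I (slice_coord2 I J (q - q0))"
    let ?H = "\<lambda>q. slice_embed I (slice_coord1 I (g q))" and ?L = "\<lambda>q. slice_embed I (slice_coord2 I J (g q))"
    have s: "slice_splitting \<Omega> I J (\<lambda>p. p - q0) ?F ?G" "slice_splitting \<Omega> I J g ?H ?L"
      using slice_splitting_coords[OF slice_regular_translation I J] slice_splitting_coords[OF g I J] by auto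
    show "\<exists>I J F G H L. I \<in> imag_units \<and> J \<in> imag_units \<and> orthogonal I J \<and>
        slice_splitting \<Omega> I J (\<lambda>p. p - q0) F G \<and> slice_splitting \<Omega> I J g H L \<and>
        (\<forall>z\<in>\<Omega> \<inter> slice_plane I.
           h z = (F z * H z - G z * qcnj (L (qcnj z))) +
                 (F z * L z + G z * qcnj (H (qcnj z))) * J)"
      apply (rule exI[of _ I], rule exI[of _ J], rule exI[of _ ?F], rule exI[of _ ?G], rule exI[of _ ?H], rule exI[of _ ?L])
      apply (intro conjI I J s ballI)
      using h_formula[OF I J _ s] by (auto simp: slice_plane_eq_range)
  next
    show "\<forall>q. q \<notin> \<Omega> \<longrightarrow> h q = 0" by (simp add: h_def)
  next
    show "slice_regular_on h \<Omega>" by (rule h_reg)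
  next
    fix h' assume h': "slice_regular_on h' \<Omega> \<and> (\<forall>q. q \<notin> \<Omega> \<longrightarrow> h' q = 0) \<and>
     (\<exists>I J F G H L. I \<in> imag_units \<and> J \<in> imag_units \<and> orthogonal I J \<and>
        slice_splitting \<Omega> I J (\<lambda>p. p - q0) F G \<and> slice_splitting \<Omega> I J g H L \<and>
        (\<forall>z\<in>\<Omega> \<inter> slice_plane I.
           h' z = (F z * H z - G z * qcnj (L (qcnj z))) +
                 (F z * L z + G z * qcnj (H (qcnj z))) * J))"
    then obtain K J F G H L where K: "K \<in> imag_units" and J: "J \<in> imag_units" "orthogonal K J"
      and s: "slice_splitting \<Omega> K J (\<lambda>p. p - q0) F G" "slice_splitting \<Omega> K J g H L"
      and eq: "\<And>z. z\<in>\<Omega> \<inter> slice_plane K \<Longrightarrow>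
           h' z = (F z * H z - G z * qcnj (L (qcnj z))) +
                 (F z * L z + G z * qcnj (H (qcnj z))) * J"
      by blast
    have "h' (slice_embed K z) = h (slice_embed K z)" if z: "slice_embed K z \<in> \<Omega>" for z
      using h_formula[OF K J z s] eq[of "slice_embed K z"] z by (simp add: slice_plane_eq_range)
    then have "h' q = h q" if "q \<in> \<Omega>" for q
      using slice_regular_eqI[OF \<Omega> _ h_reg K _ that] h' by blast
    then show "h' = h"
      using h' by (auto simp: fun_eq_iff h_def)
  qed
  then show "slice_regular_on (regular_product \<Omega> (\<lambda>p. p - q0) g) \<Omega>"
    and "slice_embed I z \<in> \<Omega> \<Longrightarrow> regular_product \<Omega> (\<lambda>p. p - q0) g (slice_embed I z) =
      (slice_embed I z - q0) * g (slice_embed I z)"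
    using h_reg slice_extend_same[OF I] by (simp_all add: h_def)
qed

text \<open>
  Each of the two complex coordinates of \<open>f\<close> has a holomorphic divided difference on the slice.
\<close>

lemma slice_divided_difference:
  assumes \<Omega>: "slice_domain \<Omega>" and f: "slice_regular_on f \<Omega>"
    and I: "I \<in> imag_units" and w0: "slice_embed I w0 \<in> \<Omega>"
  obtains g where
    "\<And>z. slice_embed I z \<in> \<Omega> \<Longrightarrow>
      \<exists>d. ((\<lambda>w. g (slice_embed I w)) has_derivative (\<lambda>w. slice_embed I w * d)) (at z)"
    "\<And>z. f (slice_embed I z) =
      f (slice_embed I w0) + (slice_embed I z - slice_embed I w0) * g (slice_embed I z)"
proof -
  obtain J where J: "J \<in> imag_units" "orthogonal I J"
    using ex_orthogonal_imag_unit[OF I] by blast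
  let ?D = "slice_embed I -` \<Omega>"
  have D: "open ?D" using \<Omega> by (simp add: slice_domain_def open_slice_vimage)
  define F G where "F = (\<lambda>z. slice_coord1 I (f (slice_embed I z)))"
    and "G = (\<lambda>z. slice_coord2 I J (f (slice_embed I z)))"
  define \<delta> where "\<delta> = (\<lambda>F z. if z = w0 then deriv F w0 else (F z - F w0) / (z - w0))"
  have hol: "\<delta> F holomorphic_on ?D" "\<delta> G holomorphic_on ?D"
    unfolding \<delta>_def F_def G_def
    by (intro pole_lemma_open D holomorphic_slice_coord1 holomorphic_slice_coord2 f I J)+
  have eq: "F z = F w0 + (z - w0) * \<delta> F z" for F z
    by (simp add: \<delta>_def)
  define g where "g = (\<lambda>q. slice_embed I (\<delta> F (slice_coord I q)) + slice_embed I (\<delta> G (slice_coord I q)) * J)"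
  show ?thesis
  proof (rule that[of g])
    fix z assume "slice_embed I z \<in> \<Omega>"
    then have "\<delta> F field_differentiable at z" "\<delta> G field_differentiable at z"
      using holomorphic_on_imp_differentiable_at[OF hol(1) D] holomorphic_on_imp_differentiable_at[OF hol(2) D]
      by blast+
    then obtain a b where a: "(\<delta> F has_field_derivative a) (at z)" and b: "(\<delta> G has_field_derivative b) (at z)"
      by (auto simp: field_differentiable_def)
    have "((\<lambda>w. g (slice_embed I w)) has_derivative (\<lambda>w. slice_embed I (a * w) + slice_embed I (b * w) * J)) (at z)"
      unfolding g_def slice_coord_embed[OF I]
      using a b unfolding has_field_derivative_def
      by (intro has_derivative_add has_derivative_mult_left bounded_linear.has_derivative[OF bounded_linear_slice_embed])
    moreover have "slice_embed I (a * w) + slice_embed I (b * w) * J = slice_embed I w * (slice_embed I a + slice_embed I b * J)" for w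
      unfolding mult.commute[of a w] mult.commute[of b w] slice_embed_mult[OF I]
      by (simp add: algebra_simps)
    ultimately show "\<exists>d. ((\<lambda>w. g (slice_embed I w)) has_derivative (\<lambda>w. slice_embed I w * d)) (at z)"
      by auto
  next
    fix z
    have f_z: "f (slice_embed I z) = slice_embed I (F z) + slice_embed I (G z) * J" for z
      unfolding F_def G_def by (rule slice_coord_decomp[OF I J])
    show "f (slice_embed I z) =
      f (slice_embed I w0) + (slice_embed I z - slice_embed I w0) * g (slice_embed I z)"
      unfolding f_z g_def slice_coord_embed[OF I]
      by (subst eq[of F z], subst eq[of G z])
        (simp add: slice_embed_add slice_embed_mult[OF I] slice_embed_diff algebra_simps)
  qed
qed

lemma continuous_eq_except_point:
  fixes f g :: "complex \<Rightarrow> 'b :: real_normed_vector"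
  assumes D: "open D" and f: "continuous_on D f" and g: "continuous_on D g"
    and eq: "\<And>z. z \<in> D \<Longrightarrow> z \<noteq> a \<Longrightarrow> f z = g z" and z: "z \<in> D"
  shows "f z = g z"
proof (cases "z = a")
  case True
  have "(f \<longlongrightarrow> f z) (at z)" "(g \<longlongrightarrow> g z) (at z)"
    using f g z by (simp_all add: continuous_on_eq_continuous_at[OF D] isCont_def)
  moreover have "eventually (\<lambda>z. f z = g z) (at z)"
    using eq eventually_at_in_open[OF D z] True by (auto elim: eventually_mono)
  ultimately have "(f \<longlongrightarrow> g z) (at z)"
    using tendsto_cong by blast
  with \<open>(f \<longlongrightarrow> f z) (at z)\<close> show ?thesis
    by (rule tendsto_unique[OF at_neq_bot])
qed (use eq z in auto)

lemma slice_regular_continuous: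
  assumes "slice_regular_on f \<Omega>" "I \<in> imag_units"
  shows "continuous_on (slice_embed I -` \<Omega>) (\<lambda>z. f (slice_embed I z))"
proof (rule continuous_at_imp_continuous_on, intro ballI)
  fix z assume "z \<in> slice_embed I -` \<Omega>"
  then have "\<exists>d. ((\<lambda>w. f (slice_embed I w)) has_derivative (\<lambda>w. slice_embed I w * d)) (at z)"
    using assms by (auto simp: slice_regular_on_iff)
  then show "isCont (\<lambda>z. f (slice_embed I z)) z"
    using has_derivative_continuous by blast
qed

lemma has_derivative_const_add_iff:
  "((\<lambda>x. c + f x) has_derivative f') F \<longleftrightarrow> (f has_derivative f') F"
  using has_derivative_add[OF has_derivative_const, of f f' F c]
    has_derivative_add[OF has_derivative_const, of "\<lambda>x. c + f x" f' F "- c"] by auto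

text \<open>
  Any two candidates for \<open>R_op\<close> agree on the slice through \<open>q0\<close>, where the defining equation can be divided
  by \<open>z - w0\<close>, and hence everywhere; the extension of the divided difference is a candidate.
\<close>

lemma R_op_slice:
  assumes \<Omega>: "slice_domain \<Omega>" "symmetric_set \<Omega>" and f: "slice_regular_on f \<Omega>"
    and I: "I \<in> imag_units" and w0: "slice_embed I w0 \<in> \<Omega>"
  shows "slice_regular_on (R_op \<Omega> (slice_embed I w0) f) \<Omega>"
    and "slice_embed I z \<in> \<Omega> \<Longrightarrow> f (slice_embed I z) = f (slice_embed I w0) +
      slice_embed I (z - w0) * R_op \<Omega> (slice_embed I w0) f (slice_embed I z)"
proof -
  let ?q0 = "slice_embed I w0" and ?D = "slice_embed I -` \<Omega>"
  have op: "open \<Omega>" using \<Omega> by (simp add: slice_domain_def)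
  have q0: "?q0 \<in> slice_plane I" by (simp add: slice_plane_eq_range)
  define P where "P = (\<lambda>g. slice_regular_on g \<Omega> \<and> (\<forall>q. q \<notin> \<Omega> \<longrightarrow> g q = 0) \<and>
     (\<forall>q\<in>\<Omega>. f q = f ?q0 + regular_product \<Omega> (\<lambda>p. p - ?q0) g q))"
  have slice: "f (slice_embed I z) = f ?q0 + (slice_embed I z - ?q0) * g (slice_embed I z)"
    if "P g" "slice_embed I z \<in> \<Omega>" for g z
    using that regular_product_translation(2)[OF \<Omega> _ I q0, of g z] by (auto simp: P_def)
  have uniq: "g = h" if g: "P g" and h: "P h" for g h
  proof -
    have reg: "slice_regular_on g \<Omega>" "slice_regular_on h \<Omega>" using g h by (auto simp: P_def)
    have "g (slice_embed I z) = h (slice_embed I z)" if "slice_embed I z \<in> \<Omega>" "z \<noteq> w0" for z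
      using slice[OF g that(1)] slice[OF h that(1)] that(2) by (auto simp: slice_embed_eq_iff[OF I])
    then have "g (slice_embed I z) = h (slice_embed I z)" if "slice_embed I z \<in> \<Omega>" for z
      using continuous_eq_except_point[OF open_slice_vimage[OF op] slice_regular_continuous[OF reg(1) I] slice_regular_continuous[OF reg(2) I], of w0 z]
        that by auto
    then have "g q = h q" if "q \<in> \<Omega>" for q
      using slice_regular_eqI[OF \<Omega> reg I _ that] by blast
    moreover have "g q = h q" if "q \<notin> \<Omega>" for q using g h that by (simp add: P_def)
    ultimately show "g = h" by blast
  qed
  obtain g1 where g1: "\<And>z. slice_embed I z \<in> \<Omega> \<Longrightarrow>
      \<exists>d. ((\<lambda>w. g1 (slice_embed I w)) has_derivative (\<lambda>w. slice_embed I w * d)) (at z)"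
    and g1_eq: "\<And>z. f (slice_embed I z) = f ?q0 + (slice_embed I z - ?q0) * g1 (slice_embed I z)"
    using slice_divided_difference[OF \<Omega>(1) f I w0] by blast
  define g where "g = (\<lambda>q. if q \<in> \<Omega> then slice_extend I g1 q else 0)"
  have g_reg: "slice_regular_on g \<Omega>"
    by (rule slice_regular_on_cong[OF op _ slice_extend_regular[OF \<Omega>(2) I g1]]) (auto simp: g_def)
  have prod_reg: "slice_regular_on (\<lambda>q. f ?q0 + regular_product \<Omega> (\<lambda>p. p - ?q0) g q) \<Omega>"
    using regular_product_translation(1)[OF \<Omega> g_reg I q0]
    unfolding slice_regular_on_iff has_derivative_const_add_iff by blast
  have "f q = f ?q0 + regular_product \<Omega> (\<lambda>p. p - ?q0) g q" if "q \<in> \<Omega>" for q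
  proof (rule slice_regular_eqI[OF \<Omega> f prod_reg I _ that])
    fix z assume z: "slice_embed I z \<in> \<Omega>"
    show "f (slice_embed I z) = f ?q0 + regular_product \<Omega> (\<lambda>p. p - ?q0) g (slice_embed I z)"
      using regular_product_translation(2)[OF \<Omega> g_reg I q0 z] g1_eq[of z] z
      by (simp add: g_def slice_extend_same[OF I])
  qed
  then have "P g" using g_reg by (auto simp: P_def g_def)
  then have "P (THE g. P g)" using uniq by (metis theI)
  then have R: "P (R_op \<Omega> ?q0 f)" unfolding P_def R_op_def .
  then show "slice_regular_on (R_op \<Omega> ?q0 f) \<Omega>" by (auto simp: P_def)
  show "slice_embed I z \<in> \<Omega> \<Longrightarrow> f (slice_embed I z) = f (slice_embed I w0) +
      slice_embed I (z - w0) * R_op \<Omega> (slice_embed I w0) f (slice_embed I z)"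
    using slice[OF R] by (simp add: slice_embed_diff)
qed

section \<open>Iterated divided differences at two conjugate nodes\<close>

text \<open>
  Substituting \<open>csqrt (w - s)\<close> into an even function gives a single-valued function of \<open>w\<close>, since evenness
  removes the sign ambiguity.  It is holomorphic where the root is unramified, by choosing a local branch,
  and continuous at \<open>s\<close>, so the singularity there is removable.
\<close>

lemma even_holomorphic_factor:
  fixes s :: complex and \<rho> :: real
  defines "V \<equiv> {u. norm (u\<^sup>2 + s) < \<rho>}"
  assumes E: "E holomorphic_on V" and even: "\<And>u. u \<in> V \<Longrightarrow> E (- u) = E u"
  obtains a where "a holomorphic_on ball 0 \<rho>" "\<And>u. u \<in> V \<Longrightarrow> E u = a (u\<^sup>2 + s)"
proof
  have V: "open V" unfolding V_def by (intro open_Collect_less continuous_intros)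
  define a where "a = (\<lambda>w. E (csqrt (w - s)))"
  have root: "E u = a w" if "u\<^sup>2 = w - s" "norm w < \<rho>" for u w
  proof -
    have "u = csqrt (w - s) \<or> u = - csqrt (w - s)"
      using that(1) by (metis power2_csqrt power2_eq_iff)
    moreover have "csqrt (w - s) \<in> V" using that(2) by (simp add: V_def)
    ultimately show ?thesis using even by (auto simp: a_def)
  qed
  show "E u = a (u\<^sup>2 + s)" if "u \<in> V" for u
    using root[of u "u\<^sup>2 + s"] that by (simp add: V_def)
  have diff: "a field_differentiable at w" if w: "norm w < \<rho>" "w \<noteq> s" for w
  proof (cases "w - s \<in> \<real>\<^sub>\<le>\<^sub>0")
    case False
    have "(\<lambda>w. csqrt (w - s)) field_differentiable at w"
      unfolding field_differentiable_def by (rule exI, rule has_field_derivative_csqrt') (auto intro!: derivative_eq_intros False)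
    moreover have "E field_differentiable at (csqrt (w - s))"
      by (rule holomorphic_on_imp_differentiable_at[OF E V]) (use w in \<open>simp add: V_def\<close>)
    ultimately show ?thesis
      unfolding a_def using field_differentiable_compose[of "\<lambda>w. csqrt (w - s)" w E] by (simp add: o_def)
  next
    case True
    \<comment> \<open>On the cut of the principal branch, use the branch \<open>\<i> * csqrt (s - w)\<close> instead.\<close>
    have nc: "s - w \<notin> \<real>\<^sub>\<le>\<^sub>0"
      using True w by (auto simp: complex_nonpos_Reals_iff complex_eq_iff)
    have "(\<lambda>w. \<i> * csqrt (s - w)) field_differentiable at w"
      by (intro field_differentiable_mult field_differentiable_const)
        (unfold field_differentiable_def, rule exI, rule has_field_derivative_csqrt', auto intro!: derivative_eq_intros nc)
    moreover have "E field_differentiable at (\<i> * csqrt (s - w))"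
      by (rule holomorphic_on_imp_differentiable_at[OF E V]) (use w in \<open>simp add: V_def power_mult_distrib\<close>)
    ultimately have "(\<lambda>w. E (\<i> * csqrt (s - w))) field_differentiable at w"
      using field_differentiable_compose[of "\<lambda>w. \<i> * csqrt (s - w)" w E] by (simp add: o_def)
    moreover have "E (\<i> * csqrt (s - w)) = a w" if "w \<in> ball 0 \<rho>" for w
      using root[of "\<i> * csqrt (s - w)" w] that by (simp add: power_mult_distrib)
    ultimately show ?thesis
      unfolding field_differentiable_def
      using has_field_derivative_transform_within_open[of "\<lambda>w. E (\<i> * csqrt (s - w))" _ w "ball 0 \<rho>" a] w
      by (metis open_ball mem_ball_0)
  qed
  have "a holomorphic_on (ball 0 \<rho> - {s})"
    using diff by (auto simp: holomorphic_on_def field_differentiable_at_within)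
  moreover have "(a \<longlongrightarrow> a w) (at w within ball 0 \<rho>)" if "w \<in> {s} \<inter> ball 0 \<rho>" for w
  proof -
    have w: "w = s" "norm s < \<rho>" using that by auto
    have "((\<lambda>w. sqrt (norm (w - s))) \<longlongrightarrow> sqrt (norm (s - s))) (at s)"
      by (intro tendsto_intros)
    then have "((\<lambda>w. csqrt (w - s)) \<longlongrightarrow> 0) (at s)"
      by (subst tendsto_norm_zero_iff[symmetric]) simp
    moreover have "0 \<in> V" using w by (simp add: V_def)
    then have "isCont E 0"
      using holomorphic_on_imp_continuous_on[OF E] V continuous_on_eq_continuous_at by blast
    ultimately have "((\<lambda>w. E (csqrt (w - s))) \<longlongrightarrow> E 0) (at s)"
      by (rule isCont_tendsto_compose[rotated])
    then show ?thesis
      unfolding w(1) a_def by (auto intro: tendsto_within_subset)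
  qed
  ultimately show "a holomorphic_on ball 0 \<rho>"
    using no_isolated_singularity'[of "{s} \<inter> ball 0 \<rho>" a "ball 0 \<rho>"]
    by (simp add: Diff_Int Diff_Int_distrib)
qed

text \<open>
  Split \<open>u \<mapsto> F (c + u)\<close> into its even and odd parts; the odd part is \<open>u\<close> times an even function.
\<close>

lemma quadratic_decomposition:
  fixes s c :: complex and \<rho> :: real
  defines "p \<equiv> \<lambda>z. (z - c)\<^sup>2 + s"
  assumes F: "F holomorphic_on {z. norm (p z) < \<rho>}"
  obtains a b where "a holomorphic_on ball 0 \<rho>" "b holomorphic_on ball 0 \<rho>"
    "\<And>z. norm (p z) < \<rho> \<Longrightarrow> F z = a (p z) + (z - c) * b (p z)"
proof -
  let ?V = "{u. norm (u\<^sup>2 + s) < \<rho>}"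
  have V: "open ?V" by (intro open_Collect_less continuous_intros)
  have F1: "(\<lambda>u. F (c + u)) holomorphic_on ?V"
    by (rule holomorphic_on_compose_gen[of "\<lambda>u. c + u" ?V F, OF _ F, unfolded o_def])
      (auto simp: p_def intro!: holomorphic_intros)
  have F2: "(\<lambda>u. F (c - u)) holomorphic_on ?V"
    by (rule holomorphic_on_compose_gen[of "\<lambda>u. c - u" ?V F, OF _ F, unfolded o_def])
      (auto simp: p_def intro!: holomorphic_intros)
  define E Q where "E = (\<lambda>u. (F (c + u) + F (c - u)) / 2)" and "Q = (\<lambda>u. (F (c + u) - F (c - u)) / 2)"
  \<comment> \<open>the odd part divided by \<open>u\<close>, with the derivative as its value at \<open>0\<close>\<close>
  define B where "B = (\<lambda>u. if u = 0 then deriv Q 0 else (Q u - Q 0) / (u - 0))"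
  have E: "E holomorphic_on ?V" and Q: "Q holomorphic_on ?V"
    unfolding E_def Q_def by (intro holomorphic_intros F1 F2; simp)+
  have B: "B holomorphic_on ?V"
    unfolding B_def by (rule pole_lemma_open[OF Q V])
  have QB: "Q u = u * B u" for u
    by (simp add: B_def Q_def)
  obtain a where a: "a holomorphic_on ball 0 \<rho>" "\<And>u. u \<in> ?V \<Longrightarrow> E u = a (u\<^sup>2 + s)"
    by (rule even_holomorphic_factor[OF E]) (auto simp: E_def add.commute)
  obtain b where b: "b holomorphic_on ball 0 \<rho>" "\<And>u. u \<in> ?V \<Longrightarrow> B u = b (u\<^sup>2 + s)"
    by (rule even_holomorphic_factor[OF B]) (auto simp: B_def Q_def field_simps)
  show ?thesis
  proof (rule that[OF a(1) b(1)])
    fix z assume z: "norm (p z) < \<rho>"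
    have "F z = E (z - c) + Q (z - c)" by (simp add: E_def Q_def field_simps)
    then show "F z = a (p z) + (z - c) * b (p z)"
      using a(2)[of "z - c"] b(2)[of "z - c"] z by (simp add: QB p_def)
  qed
qed

text \<open>
  By concavity of the sine, its graph lies above the chords to the maximum.
\<close>

lemma sin_pi_ge_dist_to_ends:
  fixes x :: real
  assumes "0 \<le> x" "x \<le> 1"
  shows "sin (pi * x) \<ge> 2 * min x (1 - x)"
proof -
  have conv: "convex_on {0..pi} (\<lambda>y. - sin y)"
    by (rule f''_ge0_imp_convex[where f' = "\<lambda>y. - cos y" and f'' = sin])
      (auto intro!: derivative_eq_intros simp: sin_ge_zero)
  have half: "sin (pi * y) \<ge> 2 * y" if "0 \<le> y" "y \<le> 1 / 2" for y :: real
    using convex_onD[OF conv, of "2 * y" 0 "pi / 2"] that by (simp add: mult.commute)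
  show ?thesis
  proof (cases "x \<le> 1 / 2")
    case True
    then show ?thesis using half[of x] assms by linarith
  next
    case False
    have "sin (pi * x) = sin (pi * (1 - x))"
      by (simp add: algebra_simps sin_diff)
    then show ?thesis using half[of "1 - x"] assms False by linarith
  qed
qed

text \<open>
  The point \<open>r e\<^sup>i\<^sup>\<theta>\<close> with \<open>\<theta> = 2 \<pi> t\<close> stays away from the whole nonnegative real axis.  The bound does not
  involve \<open>s\<close>, which makes the coefficient estimate uniform in the position of the branch value.
\<close>

lemma circle_dist_nonneg_real:
  fixes r s t :: real
  assumes "r > 0" "s \<ge> 0" "0 \<le> t" "t \<le> 1"
  shows "norm (of_real r * exp (2 * of_real pi * \<i> * of_real t) - of_real s) \<ge> r * sin (pi * t)"
proof -
  define C where "C = cos (2 * (pi * t))"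
  have C: "C \<le> 1" "-1 \<le> C" by (simp_all add: C_def)
  have e: "exp (2 * of_real pi * \<i> * of_real t) = Complex C (sin (2 * (pi * t)))"
  proof -
    have "2 * of_real pi * \<i> * of_real t = \<i> * complex_of_real (2 * (pi * t))" by simp
    then show ?thesis
      unfolding C_def by (simp only: cis_conv_exp[symmetric]) (simp add: complex_eq_iff)
  qed
  have "(norm (of_real r * exp (2 * of_real pi * \<i> * of_real t) - complex_of_real s))\<^sup>2
      = (r * C - s)\<^sup>2 + (r * sin (2 * (pi * t)))\<^sup>2"
    unfolding e cmod_power2 by simp
  also have "\<dots> = r\<^sup>2 - 2 * r * s * C + s\<^sup>2"
    using sin_cos_squared_add[of "2 * (pi * t)"] unfolding C_def[symmetric]
    by (simp add: power2_eq_square algebra_simps) algebra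
  finally have n: "(norm (of_real r * exp (2 * of_real pi * \<i> * of_real t) - complex_of_real s))\<^sup>2
     = r\<^sup>2 - 2 * r * s * C + s\<^sup>2" .
  have "C = 1 - 2 * (sin (pi * t))\<^sup>2" unfolding C_def by (rule cos_double_sin)
  then have "(r * sin (pi * t))\<^sup>2 = r\<^sup>2 * (1 - C) / 2" by (simp add: power_mult_distrib)
  also have "\<dots> \<le> r\<^sup>2 - 2 * r * s * C + s\<^sup>2"
  proof (cases "C \<ge> 0")
    case True
    \<comment> \<open>this expression is the difference of the two sides\<close>
    have "(s - r * C)\<^sup>2 + r\<^sup>2 * ((1 - C) * (1 + 2 * C)) / 2 \<ge> 0"
      using True C by (intro add_nonneg_nonneg) auto
    then show ?thesis by (simp add: power2_eq_square field_simps)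
  next
    case False
    have "r * s * (- C) \<ge> 0" using False assms by (intro mult_nonneg_nonneg) auto
    then have "2 * r * s * C \<le> 0" by (simp add: mult_ac)
    moreover have "r\<^sup>2 * (1 - C) \<le> r\<^sup>2 * 2" using C by (intro mult_left_mono) auto
    moreover have "s\<^sup>2 \<ge> 0" by simp
    ultimately show ?thesis by linarith
  qed
  finally have "(r * sin (pi * t))\<^sup>2 \<le> (norm (of_real r * exp (2 * of_real pi * \<i> * of_real t) - complex_of_real s))\<^sup>2"
    unfolding n .
  then show ?thesis by (rule power2_le_imp_le) simp
qed

lemma has_integral_inverse_sqrt_ends:
  "((\<lambda>x. 1 / sqrt (2 * x) + 1 / sqrt (2 * (1 - x))) has_integral (2 * sqrt 2)) {0<..<1::real}"
proof -
  have "((\<lambda>x. 1 / sqrt (2 * x) + 1 / sqrt (2 * (1 - x))) has_integral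
     ((sqrt (2 * 1) - sqrt (2 * (1 - 1))) - (sqrt (2 * 0) - sqrt (2 * (1 - 0))))) {0..1::real}"
  proof (rule fundamental_theorem_of_calculus_interior)
    show "continuous_on {0..1} (\<lambda>x::real. sqrt (2 * x) - sqrt (2 * (1 - x)))"
      by (intro continuous_intros)
    fix x :: real assume "x \<in> {0<..<1}"
    then show "((\<lambda>x. sqrt (2 * x) - sqrt (2 * (1 - x))) has_vector_derivative
        1 / sqrt (2 * x) + 1 / sqrt (2 * (1 - x))) (at x)"
      unfolding has_real_derivative_iff_has_vector_derivative[symmetric]
      by (auto intro!: derivative_eq_intros simp: field_simps)
  qed simp
  then show ?thesis by (simp add: has_integral_Icc_iff_Ioo)
qed

text \<open>
  The variant of Cauchy's inequality for functions that may be as large as \<open>|w - s|\<^sup>-\<^sup>1\<^sup>/\<^sup>2\<close> on the circle.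
  The circle is parametrised over \<open>[0, 1]\<close>, where the singular weight is dominated by an explicitly
  integrable function.
\<close>

lemma taylor_coeff_bound_inverse_sqrt:
  fixes r s M :: real
  assumes r: "r > 0" and s: "s \<ge> 0" and M: "M \<ge> 0"
    and cont: "continuous_on (cball 0 r) b" and hol: "b holomorphic_on ball 0 r"
    and bound: "\<And>w. norm w = r \<Longrightarrow> norm (b w) * sqrt (norm (w - of_real s)) \<le> M"
  shows "norm ((deriv ^^ k) b 0 / fact k) \<le> 3 * M / (sqrt r * r ^ k)"
proof -
  let ?g = "\<lambda>x::real. of_real r * exp (2 * of_real pi * \<i> * of_real x) :: complex"
  let ?i = "\<lambda>x. b (?g x) / ?g x ^ Suc k * (2 * of_real pi * \<i> * ?g x)"
  let ?I = "(2 * pi * \<i>) / (fact k) * (deriv ^^ k) b 0"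
  have "((\<lambda>u. b u / (u - 0) ^ Suc k) has_contour_integral ?I) (circlepath 0 r)"
    by (rule Cauchy_has_contour_integral_higher_derivative_circlepath[OF cont hol]) (use r in simp)
  then have "(?i has_integral ?I) {0..1}"
    unfolding has_contour_integral_def
  proof (rule has_integral_eq[rotated])
    fix x :: real assume "x \<in> {0..1}"
    then have "vector_derivative (circlepath 0 r) (at x within {0..1}) = 2 * of_real pi * \<i> * ?g x"
      by (simp add: vector_derivative_circlepath01)
    moreover have "circlepath 0 r x = ?g x" by (simp add: circlepath)
    ultimately show "b (circlepath 0 r x) / (circlepath 0 r x - 0) ^ Suc k *
        vector_derivative (circlepath 0 r) (at x within {0..1}) = ?i x"
      by simp
  qed
  then have int: "(?i has_integral ?I) {0<..<1}"
    by (simp add: has_integral_Icc_iff_Ioo)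
  let ?c = "2 * pi / r ^ k * (M / sqrt r)"
  have maj: "((\<lambda>x. ?c * (1 / sqrt (2 * x) + 1 / sqrt (2 * (1 - x)))) has_integral ?c * (2 * sqrt 2)) {0<..<1}"
    by (rule has_integral_mult_right[OF has_integral_inverse_sqrt_ends])
  have "norm (integral {0<..<1} ?i) \<le> integral {0<..<1} (\<lambda>x. ?c * (1 / sqrt (2 * x) + 1 / sqrt (2 * (1 - x))))"
  proof (rule integral_norm_bound_integral)
    show "?i integrable_on {0<..<1}" using int by blast
    show "(\<lambda>x. ?c * (1 / sqrt (2 * x) + 1 / sqrt (2 * (1 - x)))) integrable_on {0<..<1}" using maj by blast
    fix x :: real assume x: "x \<in> {0<..<1}"
    have ng: "norm (?g x) = r" using r by (simp add: norm_mult)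
    have m: "min x (1 - x) > 0" using x by simp
    have "r * (2 * min x (1 - x)) \<le> norm (?g x - of_real s)"
      using circle_dist_nonneg_real[OF r s, of x] sin_pi_ge_dist_to_ends[of x] x r
      by (smt (verit) greaterThanLessThan_iff mult_left_mono)
    then have le: "sqrt (r * (2 * min x (1 - x))) \<le> sqrt (norm (?g x - of_real s))" by simp
    have pos: "sqrt (r * (2 * min x (1 - x))) > 0" using r m by simp
    have "norm (b (?g x)) * sqrt (r * (2 * min x (1 - x))) \<le> M"
      using mult_left_mono[OF le, of "norm (b (?g x))"] bound[OF ng] by simp
    then have "norm (b (?g x)) \<le> M / sqrt (r * (2 * min x (1 - x)))"
      using pos by (simp add: pos_le_divide_eq)
    also have "\<dots> = M / sqrt r * (1 / sqrt (2 * min x (1 - x)))"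
      by (simp add: real_sqrt_mult)
    also have "\<dots> \<le> M / sqrt r * (1 / sqrt (2 * x) + 1 / sqrt (2 * (1 - x)))"
    proof (rule mult_left_mono)
      show "1 / sqrt (2 * min x (1 - x)) \<le> 1 / sqrt (2 * x) + 1 / sqrt (2 * (1 - x))"
        using x by (cases "x \<le> 1 - x") (simp_all add: min_def)
    qed (use M r in simp)
    finally have nb: "norm (b (?g x)) \<le> M / sqrt r * (1 / sqrt (2 * x) + 1 / sqrt (2 * (1 - x)))" .
    have "norm (?i x) = 2 * pi / r ^ k * norm (b (?g x))"
      unfolding norm_mult norm_divide norm_power ng using r by (simp add: norm_mult ng)
    also have "\<dots> \<le> 2 * pi / r ^ k * (M / sqrt r * (1 / sqrt (2 * x) + 1 / sqrt (2 * (1 - x))))"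
      by (rule mult_left_mono[OF nb]) (use r in simp)
    finally show "norm (?i x) \<le> ?c * (1 / sqrt (2 * x) + 1 / sqrt (2 * (1 - x)))"
      by (simp only: mult.assoc)
  qed
  then have "norm ?I \<le> ?c * (2 * sqrt 2)"
    unfolding integral_unique[OF int] integral_unique[OF maj] .
  then have "2 * pi * norm ((deriv ^^ k) b 0 / fact k) \<le> 2 * pi * (2 * sqrt 2 * (M / (sqrt r * r ^ k)))"
    by (simp add: norm_mult norm_divide mult_ac)
  then have "norm ((deriv ^^ k) b 0 / fact k) \<le> 2 * sqrt 2 * (M / (sqrt r * r ^ k))"
    by (rule mult_left_le_imp_le) simp
  \<comment> \<open>\<open>2 * sqrt 2\<close> is the integral of the singular weight; round it up\<close>
  also have "\<dots> \<le> 3 * (M / (sqrt r * r ^ k))"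
  proof (rule mult_right_mono)
    have "sqrt 2 \<le> 3 / 2" by (rule real_le_lsqrt) (simp_all add: power2_eq_square)
    then show "2 * sqrt 2 \<le> (3::real)" by simp
  qed (use r M in simp)
  finally show ?thesis by simp
qed

text \<open>
  A compact sublevel set inside an open set leaves some room: on the compact remainder of a larger sublevel
  set, \<open>p\<close> attains its minimum, which exceeds \<open>r\<close>.
\<close>

lemma open_contains_larger_sublevel:
  fixes p :: "complex \<Rightarrow> real"
  assumes D: "open D" and p: "continuous_on UNIV p" and bdd: "bounded {z. p z \<le> r + 1}"
    and sub: "{z. p z \<le> r} \<subseteq> D"
  obtains \<rho> where "\<rho> > r" "{z. p z < \<rho>} \<subseteq> D"
proof -
  let ?S = "{z. p z \<le> r + 1} - D"
  have "compact ?S"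
    using D bdd by (intro compact_diff) (auto simp: compact_eq_bounded_closed intro!: closed_Collect_le p)
  show ?thesis
  proof (cases "?S = {}")
    case True
    then show ?thesis by (intro that[of "r + 1"]) auto
  next
    case False
    then obtain z0 where z0: "z0 \<in> ?S" "\<And>z. z \<in> ?S \<Longrightarrow> p z0 \<le> p z"
      using continuous_attains_inf[OF \<open>compact ?S\<close> False continuous_on_subset[OF p]] by auto
    have "p z0 > r" using z0(1) sub by force
    moreover have "z \<in> D" if "p z < p z0" for z
      using that z0(1) z0(2)[of z] by (cases "z \<in> D") auto
    then have "{z. p z < p z0} \<subseteq> D" by blast
    ultimately show ?thesis by (rule that)
  qed
qed

lemma bounded_quadratic_sublevel:
  fixes c s :: complex
  shows "bounded {z. norm ((z - c)\<^sup>2 + s) \<le> r}"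
proof (rule boundedI)
  fix z assume "z \<in> {z. norm ((z - c)\<^sup>2 + s) \<le> r}"
  then have "(norm (z - c))\<^sup>2 \<le> r + norm s"
    using norm_triangle_ineq4[of "(z - c)\<^sup>2 + s" s] by (simp add: norm_power)
  then have "norm (z - c) \<le> sqrt (r + norm s)"
    by (rule real_le_rsqrt)
  then show "norm z \<le> sqrt (r + norm s) + norm c"
    using norm_triangle_ineq[of "z - c" c] by simp
qed

text \<open>
  By the open mapping theorem, \<open>|p|\<close> has no local minimum at a point where \<open>p\<close> does not vanish.
\<close>

lemma quadratic_level_approachable:
  fixes c s z :: complex
  assumes r: "norm ((z - c)\<^sup>2 + s) = r" "r > 0" and e: "e > 0"
  obtains w where "norm ((w - c)\<^sup>2 + s) < r" "dist w z < e"
proof -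
  let ?p = "\<lambda>w. (w - c)\<^sup>2 + s"
  have "?p c \<noteq> ?p (c + 1)" by simp
  then have "\<not> ?p constant_on UNIV" unfolding constant_on_def by (metis UNIV_I)
  then have "open (?p ` ball z e)"
    by (intro open_mapping_thm[of ?p UNIV]) (auto intro!: holomorphic_intros)
  moreover have "?p z \<in> ?p ` ball z e" using e by auto
  ultimately obtain d where d: "d > 0" "ball (?p z) d \<subseteq> ?p ` ball z e"
    using open_contains_ball by blast
  define t where "t = min (1/2) (d / (2 * r))"
  have t: "0 < t" "t \<le> 1/2" "t * r < d"
  proof -
    have "t * r \<le> d / (2 * r) * r" using r(2) by (intro mult_right_mono) (auto simp: t_def)
    then show "t * r < d" using d(1) r(2) by simp
  qed (use d(1) r(2) in \<open>auto simp: t_def\<close>)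
  have "dist (?p z) (of_real (1 - t) * ?p z) = norm (of_real t * ?p z)"
    by (simp add: dist_norm algebra_simps)
  then have "dist (?p z) (of_real (1 - t) * ?p z) = t * r"
    unfolding norm_mult r(1) using t(1) by simp
  then have "of_real (1 - t) * ?p z \<in> ball (?p z) d" using t(3) by simp
  then obtain w where w: "w \<in> ball z e" "?p w = of_real (1 - t) * ?p z"
    using d(2) by force
  have "norm (?p w) = (1 - t) * r"
    unfolding w(2) norm_mult r(1) norm_of_real using t(2) by simp
  also have "\<dots> < r" using t(1) r(2) by simp
  finally show ?thesis using that[of w] w(1) by (simp add: dist_commute)
qed

text \<open>
  The sum of the power series with the first \<open>k\<close> coefficients removed and the others shifted down.
\<close>

definition powser_tail :: "(nat \<Rightarrow> complex) \<Rightarrow> nat \<Rightarrow> complex \<Rightarrow> complex" where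
  "powser_tail c k w = (\<Sum>j. c (j + k) * w ^ j)"

lemma powser_tail_Suc:
  assumes "summable (\<lambda>n. c n * w ^ n)"
  shows "powser_tail c k w = c k + w * powser_tail c (Suc k) w"
  using powser_split_head(1)[of "\<lambda>n. c (n + k)" w] assms
  by (simp add: powser_tail_def summable_powser_ignore_initial_segment)

lemma powser_tail_zero: "powser_tail c k 0 = c k"
  by (simp add: powser_tail_def)

lemma powser_tail_holomorphic:
  assumes "\<And>w. w \<in> ball 0 \<rho> \<Longrightarrow> summable (\<lambda>n. c n * w ^ n)"
  shows "powser_tail c k holomorphic_on ball 0 \<rho>"
proof (rule power_series_holomorphic)
  fix w :: complex assume "w \<in> ball 0 \<rho>"
  then have "summable (\<lambda>n. c (n + k) * w ^ n)"
    using assms by (simp add: summable_powser_ignore_initial_segment)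
  then show "(\<lambda>n. c (n + k) * (w - 0) ^ n) sums powser_tail c k w"
    by (simp add: powser_tail_def summable_sums)
qed

text \<open>
  The functions \<open>f k\<close> and \<open>h k\<close> are the divided differences of \<open>f 0\<close> with \<open>2 k\<close> and \<open>2 k + 1\<close> nodes
  taken alternately from \<open>w0\<close> and \<open>cnj w0\<close>.  If \<open>f 0 = a \<circ> p + (z - x0) (b \<circ> p)\<close>, then \<open>f k\<close> has the same
  form with the \<open>k\<close>-th tails of the Taylor series of \<open>a\<close> and \<open>b\<close>.  As \<open>p\<close> vanishes at both nodes, the
  values at the nodes are expressed through the \<open>k\<close>-th Taylor coefficients.
\<close>

lemma iterated_divided_difference_bounds:
  fixes x0 y0 R M :: real and f h :: "nat \<Rightarrow> complex \<Rightarrow> complex"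
  defines "w0 \<equiv> Complex x0 y0" and "p \<equiv> \<lambda>z. (z - of_real x0)\<^sup>2 + (of_real y0)\<^sup>2"
  assumes D: "open D" "{z. norm (p z) \<le> R\<^sup>2} \<subseteq> D" and R: "R > 0"
    and f: "f 0 holomorphic_on D" "\<And>k. continuous_on D (f k)" "\<And>k. continuous_on D (h k)"
    and step1: "\<And>k z. z \<in> D \<Longrightarrow> f k z = f k w0 + (z - w0) * h k z"
    and step2: "\<And>k z. z \<in> D \<Longrightarrow> h k z = h k (cnj w0) + (z - cnj w0) * f (Suc k) z"
    and M: "\<And>z. norm (p z) = R\<^sup>2 \<Longrightarrow> norm (f 0 z) \<le> M"
  shows "norm (f k w0) \<le> (1 + 3 * \<bar>y0\<bar> / R) * (M / R ^ (2 * k))"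
    and "norm (h k (cnj w0)) \<le> 3 * (M / R ^ (2 * k + 1))"
proof -
  have pfac: "p z = (z - w0) * (z - cnj w0)" for z
  proof -
    have "w0 = of_real x0 + \<i> * of_real y0" "cnj w0 = of_real x0 - \<i> * of_real y0"
      by (simp_all add: w0_def complex_eq_iff)
    then show ?thesis by (simp add: p_def power2_eq_square algebra_simps)
  qed
  have pcont: "continuous_on A p" for A unfolding p_def by (intro continuous_intros)
  have bdd: "bounded {z. norm (p z) \<le> R\<^sup>2 + 1}"
    unfolding p_def by (rule bounded_quadratic_sublevel)
  obtain \<rho> where \<rho>: "\<rho> > R\<^sup>2" "{z. norm (p z) < \<rho>} \<subseteq> D"
    by (rule open_contains_larger_sublevel[of D "\<lambda>z. norm (p z)" "R\<^sup>2"])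
      (use D bdd pcont in \<open>auto intro!: continuous_intros\<close>)
  define V where "V = {z. norm (p z) < \<rho>}"
  have V: "open V" unfolding V_def by (intro open_Collect_less continuous_intros pcont)
  have VD: "V \<subseteq> D" using \<rho> by (simp add: V_def)
  have \<rho>pos: "\<rho> > 0" using \<rho>(1) by (smt (verit) zero_le_power2)
  have "w0 \<in> V" "cnj w0 \<in> V" using \<rho>pos by (auto simp: V_def pfac)
  obtain a b where a: "a holomorphic_on ball 0 \<rho>" and b: "b holomorphic_on ball 0 \<rho>"
    and ab: "\<And>z. norm (p z) < \<rho> \<Longrightarrow> f 0 z = a (p z) + (z - of_real x0) * b (p z)"
    using quadratic_decomposition[of "f 0" "of_real x0" "(of_real y0)\<^sup>2" \<rho>] holomorphic_on_subset[OF f(1) \<rho>(2)]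
    unfolding p_def by blast
  define ca cb where "ca = (\<lambda>n. (deriv ^^ n) a 0 / fact n)" and "cb = (\<lambda>n. (deriv ^^ n) b 0 / fact n)"
  have sa: "(\<lambda>n. ca n * w ^ n) sums a w" and sb: "(\<lambda>n. cb n * w ^ n) sums b w" if "w \<in> ball 0 \<rho>" for w
    using holomorphic_power_series[OF a that] holomorphic_power_series[OF b that] by (simp_all add: ca_def cb_def)
  let ?A = "powser_tail ca" and ?B = "powser_tail cb"
  have ser: "summable (\<lambda>n. ca n * w ^ n)" "summable (\<lambda>n. cb n * w ^ n)" if "w \<in> ball 0 \<rho>" for w
    using sa[OF that] sb[OF that] by (auto simp: sums_iff)
  have tail_cont: "continuous_on V (\<lambda>z. ?A k (p z))" "continuous_on V (\<lambda>z. ?B k (p z))" for k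
    by (rule continuous_on_compose2[of "ball 0 \<rho>" _ V p];
        use ser in \<open>auto intro!: holomorphic_on_imp_continuous_on powser_tail_holomorphic pcont simp: V_def\<close>)+
  \<comment> \<open>The equations divide out \<open>z - w0\<close> or \<open>z - cnj w0\<close>, so they hold at the node itself only by continuity.\<close>
  have main: "f k z = ?A k (p z) + (z - of_real x0) * ?B k (p z)
      \<and> h k z = cb k + (z - cnj w0) * (?A (Suc k) (p z) + (z - of_real x0) * ?B (Suc k) (p z))"
    if fk: "\<And>z. z \<in> V \<Longrightarrow> f k z = ?A k (p z) + (z - of_real x0) * ?B k (p z)" and z: "z \<in> V" for k z
  proof -
    have "h k z = cb k + (z - cnj w0) * (?A (Suc k) (p z) + (z - of_real x0) * ?B (Suc k) (p z))"
    proof (rule continuous_eq_except_point[where a = w0, OF V _ _ _ z])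
      show "continuous_on V (h k)" using f(3) VD continuous_on_subset by blast
      show "continuous_on V (\<lambda>z. cb k + (z - cnj w0) * (?A (Suc k) (p z) + (z - of_real x0) * ?B (Suc k) (p z)))"
        by (intro continuous_intros tail_cont)
      fix z assume z: "z \<in> V" "z \<noteq> w0"
      have pz: "p z \<in> ball 0 \<rho>" using z by (simp add: V_def)
      have fw: "f k w0 = ca k + (w0 - of_real x0) * cb k"
        using fk[OF \<open>w0 \<in> V\<close>] by (simp add: pfac powser_tail_zero)
      have hz: "(z - w0) * h k z = f k z - f k w0"
        using step1[of z k] z VD by auto
      have "(z - w0) * h k z = (?A k (p z) - ca k) + (z - of_real x0) * (?B k (p z) - cb k) + (z - w0) * cb k"
        unfolding hz fw fk[OF z(1)] by (simp add: algebra_simps)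
      also have "\<dots> = (z - w0) * (cb k + (z - cnj w0) * (?A (Suc k) (p z) + (z - of_real x0) * ?B (Suc k) (p z)))"
      proof -
        have eqs: "?A k (p z) = ca k + (z - w0) * (z - cnj w0) * ?A (Suc k) (p z)"
          "?B k (p z) = cb k + (z - w0) * (z - cnj w0) * ?B (Suc k) (p z)"
          unfolding pfac[symmetric] by (rule powser_tail_Suc[OF ser(1)[OF pz]] powser_tail_Suc[OF ser(2)[OF pz]])+
        show ?thesis unfolding eqs by (simp add: algebra_simps)
      qed
      finally show "h k z = cb k + (z - cnj w0) * (?A (Suc k) (p z) + (z - of_real x0) * ?B (Suc k) (p z))"
        using z(2) by simp
    qed
    then show ?thesis using fk[OF z] by simp
  qed
  have decomp: "f k z = ?A k (p z) + (z - of_real x0) * ?B k (p z)" if "z \<in> V" for k z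
    using that
  proof (induction k arbitrary: z)
    case 0
    then have "p z \<in> ball 0 \<rho>" by (simp add: V_def)
    then show ?case
      using ab[of z] sa sb by (simp add: powser_tail_def sums_iff)
  next
    case (Suc k)
    show ?case
    proof (rule continuous_eq_except_point[where a = "cnj w0", OF V _ _ _ Suc.prems])
      show "continuous_on V (f (Suc k))" using f(2) VD continuous_on_subset by blast
      show "continuous_on V (\<lambda>z. ?A (Suc k) (p z) + (z - of_real x0) * ?B (Suc k) (p z))"
        by (intro continuous_intros tail_cont)
      fix z assume z: "z \<in> V" "z \<noteq> cnj w0"
      have "h k (cnj w0) = cb k" using main[OF Suc.IH \<open>cnj w0 \<in> V\<close>] by simp
      then have "(z - cnj w0) * f (Suc k) z = (z - cnj w0) * (?A (Suc k) (p z) + (z - of_real x0) * ?B (Suc k) (p z))"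
        using main[OF Suc.IH z(1)] step2[of z k] z VD by auto
      then show "f (Suc k) z = ?A (Suc k) (p z) + (z - of_real x0) * ?B (Suc k) (p z)"
        using z(2) by simp
    qed
  qed
  have hk: "h k (cnj w0) = cb k"
    using main[OF decomp \<open>cnj w0 \<in> V\<close>] by simp
  have fk: "f k w0 = ca k + \<i> * of_real y0 * cb k"
  proof -
    have "w0 - of_real x0 = \<i> * of_real y0" by (simp add: w0_def complex_eq_iff)
    then show ?thesis using decomp[OF \<open>w0 \<in> V\<close>, of k] by (simp add: pfac powser_tail_zero)
  qed
  have bounds: "norm (a w) \<le> M" "norm (b w) * sqrt (norm (w - of_real (y0\<^sup>2))) \<le> M" if w: "norm w = R\<^sup>2" for w
  proof -
    \<comment> \<open>the two preimages of \<open>w\<close> under \<open>p\<close> are \<open>x0 + u\<close> and \<open>x0 - u\<close>\<close>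
    define u where "u = csqrt (w - of_real (y0\<^sup>2))"
    have p: "p (of_real x0 + u) = w" "p (of_real x0 - u) = w"
      by (simp_all add: p_def u_def)
    have le: "norm (f 0 (of_real x0 + u)) \<le> M" "norm (f 0 (of_real x0 - u)) \<le> M"
      using M p w by auto
    have eq: "f 0 (of_real x0 + u) = a w + u * b w" "f 0 (of_real x0 - u) = a w - u * b w"
      using ab[of "of_real x0 + u"] ab[of "of_real x0 - u"] p w \<rho> by auto
    have "2 * a w = f 0 (of_real x0 + u) + f 0 (of_real x0 - u)" by (simp add: eq)
    then have "norm (2 * a w) \<le> 2 * M" using le norm_triangle_ineq by (smt (verit))
    then show "norm (a w) \<le> M" by (simp add: norm_mult)
    have "2 * (u * b w) = f 0 (of_real x0 + u) - f 0 (of_real x0 - u)" by (simp add: eq)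
    then have "norm (2 * (u * b w)) \<le> 2 * M" using le norm_triangle_ineq4 by (smt (verit))
    then have "norm (b w) * norm u \<le> M" by (simp add: norm_mult mult.commute)
    then show "norm (b w) * sqrt (norm (w - of_real (y0\<^sup>2))) \<le> M" by (simp add: u_def)
  qed
  have "norm (of_real (R\<^sup>2) :: complex) = R\<^sup>2" by (simp add: norm_power)
  then have M0: "M \<ge> 0" using bounds(1) norm_ge_zero order_trans by blast
  have sub: "cball 0 (R\<^sup>2) \<subseteq> ball (0::complex) \<rho>" "ball 0 (R\<^sup>2) \<subseteq> ball (0::complex) \<rho>" using \<rho>(1) by auto
  have cont: "continuous_on (cball 0 (R\<^sup>2)) a" "continuous_on (cball 0 (R\<^sup>2)) b"
    using a b sub(1) holomorphic_on_imp_continuous_on holomorphic_on_subset by metis+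
  have hol: "a holomorphic_on ball 0 (R\<^sup>2)" "b holomorphic_on ball 0 (R\<^sup>2)"
    using a b sub(2) holomorphic_on_subset by metis+
  have R2: "R\<^sup>2 > 0" using R by simp
  have "norm ((deriv ^^ k) a 0) \<le> fact k * M / (R\<^sup>2) ^ k"
    by (rule Cauchy_inequality[OF hol(1) cont(1) R2]) (use bounds(1) in simp)
  then have ca: "norm (ca k) \<le> M / R ^ (2 * k)"
    unfolding power_mult by (simp add: ca_def norm_divide pos_divide_le_eq mult.commute)
  have "norm (cb k) \<le> 3 * M / (sqrt (R\<^sup>2) * (R\<^sup>2) ^ k)"
    unfolding cb_def
    by (rule taylor_coeff_bound_inverse_sqrt[OF R2 _ M0 cont(2) hol(2) bounds(2)]) simp_all
  then have cb: "norm (cb k) \<le> 3 * (M / R ^ (2 * k + 1))"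
    unfolding power_add power_mult using R by (simp add: mult.commute)
  then show "norm (h k (cnj w0)) \<le> 3 * (M / R ^ (2 * k + 1))" by (simp add: hk)
  have "norm (f k w0) \<le> norm (ca k) + \<bar>y0\<bar> * norm (cb k)"
    unfolding fk using norm_triangle_ineq[of "ca k" "\<i> * of_real y0 * cb k"] by (simp add: norm_mult)
  also have "\<dots> \<le> M / R ^ (2 * k) + \<bar>y0\<bar> * (3 * (M / R ^ (2 * k + 1)))"
    by (intro add_mono ca mult_left_mono cb) simp
  also have "\<dots> = (1 + 3 * \<bar>y0\<bar> / R) * (M / R ^ (2 * k))"
    using R by (simp add: field_simps)
  finally show "norm (f k w0) \<le> (1 + 3 * \<bar>y0\<bar> / R) * (M / R ^ (2 * k))" .
qed

section \<open>Estimate of the spherical coefficients\<close>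

lemma norm_quadratic_slice_embed:
  assumes J: "J \<in> imag_units"
  shows "norm ((slice_embed J z - of_real x0)\<^sup>2 + (of_real y0)\<^sup>2) =
    norm ((z - of_real x0)\<^sup>2 + (of_real y0 :: complex)\<^sup>2)"
proof -
  have "(slice_embed J z - of_real x0)\<^sup>2 + (of_real y0)\<^sup>2 =
      slice_embed J ((z - of_real x0)\<^sup>2 + (of_real y0)\<^sup>2)"
    by (simp add: power2_eq_square slice_embed_add slice_embed_mult[OF J] slice_embed_diff slice_embed_of_real)
  then show ?thesis by (simp add: norm_slice_embed[OF J])
qed

lemma slice_embed_in_U_nbhd_iff:
  assumes "J \<in> imag_units"
  shows "slice_embed J z \<in> U_nbhd x0 y0 R \<longleftrightarrow> norm ((z - of_real x0)\<^sup>2 + (of_real y0)\<^sup>2) < R\<^sup>2"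
  by (simp add: U_nbhd_def norm_quadratic_slice_embed[OF assms])

lemma closure_U_nbhd_le:
  assumes "q \<in> closure (U_nbhd x0 y0 R)"
  shows "norm ((q - of_real x0)\<^sup>2 + (of_real y0)\<^sup>2) \<le> R\<^sup>2"
proof -
  have "closed {q :: quat. norm ((q - of_real x0)\<^sup>2 + (of_real y0)\<^sup>2) \<le> R\<^sup>2}"
    by (intro closed_Collect_le continuous_intros)
  then have "closure (U_nbhd x0 y0 R) \<subseteq> {q. norm ((q - of_real x0)\<^sup>2 + (of_real y0)\<^sup>2) \<le> R\<^sup>2}"
    by (intro closure_minimal) (auto simp: U_nbhd_def)
  then show ?thesis using assms by blast
qed

text \<open>
  The points of the level set really are boundary points of \<open>U\<close>: they are not local minima of \<open>|p|\<close>.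
  This is what allows bounding \<open>F\<close> on the Cassini oval by the supremum over the boundary of \<open>U\<close>.
\<close>

lemma slice_level_in_frontier:
  assumes J: "J \<in> imag_units" and R: "R > 0"
    and z: "norm ((z - of_real x0)\<^sup>2 + (of_real y0)\<^sup>2) = R\<^sup>2"
  shows "slice_embed J z \<in> frontier (U_nbhd x0 y0 R)"
proof -
  have "open (U_nbhd x0 y0 R)"
    unfolding U_nbhd_def by (intro open_Collect_less continuous_intros)
  then have "frontier (U_nbhd x0 y0 R) = closure (U_nbhd x0 y0 R) - U_nbhd x0 y0 R"
    by (simp add: frontier_def interior_open)
  moreover have "slice_embed J z \<notin> U_nbhd x0 y0 R"
    using z by (simp add: slice_embed_in_U_nbhd_iff[OF J])
  moreover have "slice_embed J z \<in> closure (U_nbhd x0 y0 R)"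
    unfolding closure_approachable
  proof (intro allI impI)
    fix e :: real assume "e > 0"
    then obtain w where w: "norm ((w - of_real x0)\<^sup>2 + (of_real y0)\<^sup>2) < R\<^sup>2" "dist w z < e"
      using quadratic_level_approachable[OF z] R by auto
    have "slice_embed J w \<in> U_nbhd x0 y0 R"
      using w(1) by (simp add: slice_embed_in_U_nbhd_iff[OF J])
    moreover have "dist (slice_embed J w) (slice_embed J z) < e"
      using w(2) by (simp add: dist_norm norm_slice_embed[OF J] flip: slice_embed_diff)
    ultimately show "\<exists>y\<in>U_nbhd x0 y0 R. dist y (slice_embed J z) < e" by blast
  qed
  ultimately show ?thesis by blast
qed

text \<open>
  The representation formula bounds \<open>|f|\<close> on each sphere by twice its maximum at the two points of the
  sphere in \<open>L_I\<close>, and in \<open>L_I\<close> these points range over a compact set.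
\<close>

lemma slice_regular_bdd_above_frontier:
  assumes \<Omega>: "slice_domain \<Omega>" "symmetric_set \<Omega>" and f: "slice_regular_on f \<Omega>"
    and I: "I \<in> imag_units"
    and sub: "{z. norm ((z - of_real x0)\<^sup>2 + (of_real y0)\<^sup>2) \<le> R\<^sup>2} \<subseteq> slice_embed I -` \<Omega>" (is "?K \<subseteq> _")
    and cl: "closure (U_nbhd x0 y0 R) \<subseteq> \<Omega>"
  shows "bdd_above ((\<lambda>q. norm (f q)) ` frontier (U_nbhd x0 y0 R))"
proof -
  have "compact ?K"
    by (auto simp: compact_eq_bounded_closed bounded_quadratic_sublevel
        intro!: closed_Collect_le continuous_intros)
  then have "bounded ((\<lambda>z. f (slice_embed I z)) ` ?K)"
    by (intro compact_imp_bounded compact_continuous_image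
        continuous_on_subset[OF slice_regular_continuous[OF f I] sub])
  then obtain B where B: "\<And>z. z \<in> ?K \<Longrightarrow> norm (f (slice_embed I z)) \<le> B"
    by (auto simp: bounded_iff)
  have "norm (f q) \<le> 2 * B" if "q \<in> frontier (U_nbhd x0 y0 R)" for q
  proof -
    have qc: "q \<in> closure (U_nbhd x0 y0 R)" using that by (simp add: frontier_def)
    obtain J x y where J: "J \<in> imag_units" and "q = of_real x + J * of_real y"
      using ex_imag_unit_form[of q] by blast
    then have qe: "q = slice_embed J (Complex x y)" by (simp add: slice_embed_def)
    define z where "z = Complex x y"
    have z: "z \<in> ?K"
      using closure_U_nbhd_le[OF qc] unfolding qe norm_quadratic_slice_embed[OF J] z_def by simp
    have "cnj ((z - of_real x0)\<^sup>2 + (of_real y0)\<^sup>2) = (cnj z - of_real x0)\<^sup>2 + (of_real y0)\<^sup>2"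
      by simp
    then have "cnj z \<in> ?K" using z by (metis (mono_tags, lifting) complex_mod_cnj mem_Collect_eq)
    then have b: "norm (f (slice_embed I z)) \<le> B" "norm (f (slice_embed I (cnj z))) \<le> B"
      using B z by auto
    have "f q = (1/2) *\<^sub>R ((f (slice_embed I z) + f (slice_embed I (cnj z))) +
         J * (I * (f (slice_embed I (cnj z)) - f (slice_embed I z))))"
      using representation_formula[OF \<Omega> f I, of q] qc cl unfolding qe z_def[symmetric] slice_extend_embed[OF J] by auto
    also have "norm \<dots> \<le> (1/2) * (norm (f (slice_embed I z) + f (slice_embed I (cnj z))) +
         norm (f (slice_embed I (cnj z)) - f (slice_embed I z)))"
      by (simp add: imag_unit_norm[OF I] imag_unit_norm[OF J] norm_mult order_trans[OF norm_triangle_ineq])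
    also have "\<dots> \<le> 2 * B"
      using b norm_triangle_ineq[of "f (slice_embed I z)" "f (slice_embed I (cnj z))"]
        norm_triangle_ineq4[of "f (slice_embed I (cnj z))" "f (slice_embed I z)"] by simp
    finally show ?thesis .
  qed
  then show ?thesis by (intro bdd_aboveI2)
qed

theorem corollary3p3:
  fixes \<Omega> :: "quat set" and f :: "quat \<Rightarrow> quat" and x0 y0 :: real and q0 :: quat
  assumes "slice_domain \<Omega>" and "symmetric_set \<Omega>"
    and "slice_regular_on f \<Omega>"
    and "sphere_at x0 y0 \<subseteq> \<Omega>"
    and "q0 \<in> sphere_at x0 y0"
  shows "\<forall>R>0. closure (U_nbhd x0 y0 R) \<subseteq> \<Omega> \<longrightarrow>
    (\<exists>C>0. \<forall>n. norm (A_coeff \<Omega> f q0 n) \<le>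
       C * ((SUP q\<in>frontier (U_nbhd x0 y0 R). norm (f q)) / R ^ n))"
proof (intro allI impI)
  fix R :: real
  assume R: "R > 0" and cl: "closure (U_nbhd x0 y0 R) \<subseteq> \<Omega>"
  note \<Omega> = assms(1,2)
  define M where "M = (SUP q\<in>frontier (U_nbhd x0 y0 R). norm (f q))"
  define w0 where "w0 = Complex x0 y0"
  obtain I where I: "I \<in> imag_units" and "q0 = of_real x0 + of_real y0 * I"
    using assms(5) by (auto simp: sphere_at_def)
  then have q0: "q0 = slice_embed I w0"
    by (simp add: w0_def slice_embed_def of_real_commute_quat)
  obtain J where J: "J \<in> imag_units" "orthogonal I J"
    using ex_orthogonal_imag_unit[OF I] by blast
  have q0c: "qcnj q0 = slice_embed I (cnj w0)"
    by (simp add: q0 slice_embed_cnj[OF I])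
  have mem: "slice_embed I w0 \<in> \<Omega>" "slice_embed I (cnj w0) \<in> \<Omega>"
    using assms(4,5) q0 symmetric_set_slice_embed[OF \<Omega>(2) _ I I, of w0] by auto
  define D where "D = slice_embed I -` \<Omega>"
  have D: "open D" using \<Omega> by (simp add: D_def slice_domain_def open_slice_vimage)

  define g where "g = (\<lambda>n. RR_iter \<Omega> q0 n f)"
  define h where "h = (\<lambda>n. R_op \<Omega> q0 (g n))"
  have g_Suc: "g (Suc n) = R_op \<Omega> (qcnj q0) (h n)" for n
    by (simp add: g_def h_def RR_iter_def)
  have g_reg: "slice_regular_on (g n) \<Omega>" for n
  proof (induction n)
    case 0
    then show ?case using assms(3) by (simp add: g_def RR_iter_def)
  next
    case (Suc n)
    then have "slice_regular_on (h n) \<Omega>"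
      unfolding h_def q0 by (rule R_op_slice(1)[OF \<Omega> _ I mem(1)])
    then show ?case
      unfolding g_Suc q0c by (rule R_op_slice(1)[OF \<Omega> _ I mem(2)])
  qed
  have h_reg: "slice_regular_on (h n) \<Omega>" for n
    unfolding h_def q0 by (rule R_op_slice(1)[OF \<Omega> g_reg I mem(1)])
  have step1: "g n (slice_embed I z) = g n (slice_embed I w0) + slice_embed I (z - w0) * h n (slice_embed I z)"
    if "z \<in> D" for n z
    using R_op_slice(2)[OF \<Omega> g_reg I mem(1), of z n] that by (simp add: h_def q0 D_def)
  have step2: "h n (slice_embed I z) = h n (slice_embed I (cnj w0)) + slice_embed I (z - cnj w0) * g (Suc n) (slice_embed I z)"
    if "z \<in> D" for n z
    using R_op_slice(2)[OF \<Omega> h_reg I mem(2), of z n] that by (simp add: g_Suc q0c D_def)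

  have inside: "{z. norm ((z - of_real x0)\<^sup>2 + (of_real y0)\<^sup>2) \<le> R\<^sup>2} \<subseteq> D"
  proof
    fix z :: complex assume "z \<in> {z. norm ((z - of_real x0)\<^sup>2 + (of_real y0)\<^sup>2) \<le> R\<^sup>2}"
    then consider "norm ((z - of_real x0)\<^sup>2 + (of_real y0)\<^sup>2) < R\<^sup>2" | "norm ((z - of_real x0)\<^sup>2 + (of_real y0)\<^sup>2) = R\<^sup>2"
      by force
    then have "slice_embed I z \<in> closure (U_nbhd x0 y0 R)"
    proof cases
      case 1
      then show ?thesis using closure_subset slice_embed_in_U_nbhd_iff[OF I] by blast
    next
      case 2
      then show ?thesis using slice_level_in_frontier[OF I R 2] by (simp add: frontier_def)
    qed
    then show "z \<in> D" using cl by (auto simp: D_def)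
  qed
  have bdd: "bdd_above ((\<lambda>q. norm (f q)) ` frontier (U_nbhd x0 y0 R))"
    by (rule slice_regular_bdd_above_frontier[OF \<Omega> assms(3) I _ cl]) (use inside in \<open>simp add: D_def\<close>)
  have le_M: "norm (f (slice_embed I z)) \<le> M" if "norm ((z - of_real x0)\<^sup>2 + (of_real y0)\<^sup>2) = R\<^sup>2" for z
    unfolding M_def by (rule cSUP_upper[OF slice_level_in_frontier[OF I R that] bdd])
  have g0: "g 0 = f" by (simp add: g_def RR_iter_def)

  \<comment> \<open>\<open>u\<close> stands for either of the two complex coordinates of the values\<close>
  have key: "norm (u (g k (slice_embed I w0))) \<le> (1 + 3 * \<bar>y0\<bar> / R) * (M / R ^ (2 * k)) \<and>
      norm (u (h k (slice_embed I (cnj w0)))) \<le> 3 * (M / R ^ (2 * k + 1))"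
    if add: "\<And>p q. u (p + q) = u p + u q" and mult: "\<And>c q. u (slice_embed I c * q) = c * u q"
      and le: "\<And>q. norm (u q) \<le> norm q"
      and hol: "\<And>\<phi>. slice_regular_on \<phi> \<Omega> \<Longrightarrow> (\<lambda>z. u (\<phi> (slice_embed I z))) holomorphic_on D"
    for u :: "quat \<Rightarrow> complex" and k
  proof -
    let ?F = "\<lambda>k z. u (g k (slice_embed I z))" and ?H = "\<lambda>k z. u (h k (slice_embed I z))"
    have F: "?F 0 holomorphic_on D" and FH: "continuous_on D (?F k)" "continuous_on D (?H k)" for k
      by (intro hol g_reg h_reg holomorphic_on_imp_continuous_on)+
    have s1: "?F k z = ?F k w0 + (z - w0) * ?H k z" if "z \<in> D" for k z
      using arg_cong[OF step1[OF that, of k], of u] unfolding add mult .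
    have s2: "?H k z = ?H k (cnj w0) + (z - cnj w0) * ?F (Suc k) z" if "z \<in> D" for k z
      using arg_cong[OF step2[OF that, of k], of u] unfolding add mult .
    have m: "norm (?F 0 z) \<le> M" if "norm ((z - of_real x0)\<^sup>2 + (of_real y0)\<^sup>2) = R\<^sup>2" for z
      unfolding g0 by (rule order_trans[OF le le_M[OF that]])
    show ?thesis
      using iterated_divided_difference_bounds[of D x0 y0 R ?F ?H M k, folded w0_def,
          OF D inside R F FH s1 s2 m] by blast
  qed
  have bound1: "norm (slice_coord1 I (g k (slice_embed I w0))) \<le> (1 + 3 * \<bar>y0\<bar> / R) * (M / R ^ (2 * k)) \<and>
      norm (slice_coord1 I (h k (slice_embed I (cnj w0)))) \<le> 3 * (M / R ^ (2 * k + 1))" for k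
    by (rule key)
      (simp_all add: linear_add[OF bounded_linear.linear[OF bounded_linear_slice_coord1]]
        slice_coord1_mult[OF I] norm_slice_coord1_le[OF I] holomorphic_slice_coord1[OF _ I] D_def)
  have bound2: "norm (slice_coord2 I J (g k (slice_embed I w0))) \<le> (1 + 3 * \<bar>y0\<bar> / R) * (M / R ^ (2 * k)) \<and>
      norm (slice_coord2 I J (h k (slice_embed I (cnj w0)))) \<le> 3 * (M / R ^ (2 * k + 1))" for k
    by (rule key)
      (simp_all add: linear_add[OF bounded_linear.linear[OF bounded_linear_slice_coord2]]
        slice_coord2_mult[OF I J] norm_slice_coord2_le[OF I J] holomorphic_slice_coord2[OF _ I J] D_def)
  have M0: "M \<ge> 0"
  proof -
    have "0 < 1 + 3 * \<bar>y0\<bar> / R" using R by (intro add_pos_nonneg) auto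
    moreover have "0 \<le> (1 + 3 * \<bar>y0\<bar> / R) * M"
      using order_trans[OF norm_ge_zero bound1[THEN conjunct1, of 0]] by simp
    ultimately show ?thesis by (simp add: zero_le_mult_iff)
  qed
  \<comment> \<open>one factor \<open>2\<close> accounts for the two complex coordinates\<close>
  define C where "C = 6 * (1 + \<bar>y0\<bar> / R)"
  have C: "C \<ge> 6" "C \<ge> 2 * (1 + 3 * \<bar>y0\<bar> / R)" using R by (simp_all add: C_def)
  have "norm (A_coeff \<Omega> f q0 n) \<le> C * (M / R ^ n)" for n
  proof (cases "even n")
    case True
    then obtain k where k: "n = 2 * k" by blast
    have A: "A_coeff \<Omega> f q0 n = g k (slice_embed I w0)"
      by (simp add: A_coeff_def k g_def q0)
    have "norm (A_coeff \<Omega> f q0 n) \<le> 2 * (1 + 3 * \<bar>y0\<bar> / R) * (M / R ^ n)"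
      using norm_le_slice_coords[OF I J, of "g k (slice_embed I w0)"]
        bound1[THEN conjunct1, of k] bound2[THEN conjunct1, of k]
      unfolding A unfolding k mult.assoc[of 2] by linarith
    also have "\<dots> \<le> C * (M / R ^ n)"
      using C(2) M0 R by (intro mult_right_mono) auto
    finally show ?thesis .
  next
    case False
    then obtain k where k: "n = 2 * k + 1" using oddE by blast
    have A: "A_coeff \<Omega> f q0 n = h k (slice_embed I (cnj w0))"
      by (simp add: A_coeff_def k h_def g_def q0c)
    have "norm (A_coeff \<Omega> f q0 n) \<le> 6 * (M / R ^ n)"
      using norm_le_slice_coords[OF I J, of "h k (slice_embed I (cnj w0))"]
        bound1[THEN conjunct2, of k] bound2[THEN conjunct2, of k]
      unfolding A unfolding k by linarith
    also have "\<dots> \<le> C * (M / R ^ n)"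
      using C(1) M0 R by (intro mult_right_mono) auto
    finally show ?thesis .
  qed
  moreover have "C > 0" using C(1) by simp
  ultimately show "\<exists>C>0. \<forall>n. norm (A_coeff \<Omega> f q0 n) \<le>
       C * ((SUP q\<in>frontier (U_nbhd x0 y0 R). norm (f q)) / R ^ n)"
    unfolding M_def by blast
qed

end
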